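(* Let $A=\mathrm{Free}(k)/I$ be an MV-algebra, where $k$ is a cardinal and $I$ is an ideal of $\mathrm{Free}(k)$. The following are equivalent: (1) $A$ is in $\mathbb V(C)$; (2) every maximal ideal of $A$ is supermaximal (that is, its quotient is $\{0,1\}$); (3) every element of $\mathrm{Spec}(A)$ is a perfect ideal; (4) every element of $V(I)$ is perfect.
   Context: An MV-algebra is a structure $(A,\oplus,0,\neg)$ such that $(A,\oplus,0)$ is a commutative monoid, $\neg\neg x=x$, $x\oplus\neg 0=\neg 0$ and $\neg(\neg x\oplus y)\oplus y=\neg(\neg y\oplus x)\oplus x$. It is a lattice with $x\vee y=\neg(\neg x\oplus y)\oplus y$, $x\wedge y=\neg(\neg x\vee\neg y)$, and $1=\neg 0$. An ideal is a nonempty downward closed subset closed under $\oplus$; an ideal $P\neq A$ is prime if $x\wedge y\in P$ implies $x\in P$ or $y\in P$. $\mathrm{Spec}(A)$ is the set of prime ideals of $A$. $\mathrm{Free}(k)$ is the free MV-algebra over $k$ generators, and $V(I)=\{P\in\mathrm{Spec}(\mathrm{Free}(k)) : I\subseteq P\}$. $C$ is the Chang MV-algebra, $C=\Gamma(\mathbb Z\ \mathrm{lex}\ \mathbb Z,(1,0))$, i.e. the interval $[(0,0),(1,0)]$ of the lexicographic product with $a\oplus b=(a+b)\wedge(1,0)$, $\neg a=(1,0)-a$; $\mathbb V(C)$ is the variety of MV-algebras generated by $C$. The order of $x\in A$ is the smallest natural number $n$ with $nx=1$ ($nx=x\oplus\cdots\oplus x$), or $\infty$ if none exists. An MV-algebra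 is perfect if for every element $x$ exactly one of $x$ and $\neg x$ is of finite order. An ideal $J$ of an MV-algebra $B$ is perfect if $B/J$ is a perfect MV-algebra. A maximal ideal $M$ of $B$ is supermaximal if $B/M=\{0,1\}$. *)

theory Defs
  imports
    Main
    "HOL-Library.FuncSet"
    "HOL-Library.Extended_Nat"
    "HOL-Library.Product_Plus"
    "HOL-Library.Product_Lexorder"
begin

section \<open>MV-algebras\<close>

record 'a mv =
  carrier :: "'a set"
  oplus :: "'a \<Rightarrow> 'a \<Rightarrow> 'a" (infixl "\<oplus>\<index>" 65)
  zero :: 'a ("\<zero>\<index>")
  neg :: "'a \<Rightarrow> 'a" ("\<sim>\<index> _" [81] 80)

text \<open>The one-element algebra (in which 0 = 1) is an MV-algebra.\<close>

locale mv_algebra =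
  fixes A :: "'a mv" (structure)
  assumes zero_closed: "\<zero> \<in> carrier A"
    and oplus_closed: "\<lbrakk>x \<in> carrier A; y \<in> carrier A\<rbrakk> \<Longrightarrow> x \<oplus> y \<in> carrier A"
    and neg_closed: "x \<in> carrier A \<Longrightarrow> \<sim> x \<in> carrier A"
    and oplus_assoc: "\<lbrakk>x \<in> carrier A; y \<in> carrier A; z \<in> carrier A\<rbrakk>
      \<Longrightarrow> (x \<oplus> y) \<oplus> z = x \<oplus> (y \<oplus> z)"
    and oplus_comm: "\<lbrakk>x \<in> carrier A; y \<in> carrier A\<rbrakk> \<Longrightarrow> x \<oplus> y = y \<oplus> x"
    and oplus_zero: "x \<in> carrier A \<Longrightarrow> x \<oplus> \<zero> = x"
    and neg_neg: "x \<in> carrier A \<Longrightarrow> \<sim> (\<sim> x) = x"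
    and oplus_neg_zero: "x \<in> carrier A \<Longrightarrow> x \<oplus> \<sim> \<zero> = \<sim> \<zero>"
    and lukasiewicz: "\<lbrakk>x \<in> carrier A; y \<in> carrier A\<rbrakk>
      \<Longrightarrow> \<sim> (\<sim> x \<oplus> y) \<oplus> y = \<sim> (\<sim> y \<oplus> x) \<oplus> x"

definition mv_one :: "'a mv \<Rightarrow> 'a" ("\<one>\<index>")
  where "\<one>\<^bsub>A\<^esub> = \<sim>\<^bsub>A\<^esub> \<zero>\<^bsub>A\<^esub>"

definition mv_join :: "'a mv \<Rightarrow> 'a \<Rightarrow> 'a \<Rightarrow> 'a"
  where "mv_join A x y = \<sim>\<^bsub>A\<^esub> (\<sim>\<^bsub>A\<^esub> x \<oplus>\<^bsub>A\<^esub> y) \<oplus>\<^bsub>A\<^esub> y"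

definition mv_meet :: "'a mv \<Rightarrow> 'a \<Rightarrow> 'a \<Rightarrow> 'a"
  where "mv_meet A x y = \<sim>\<^bsub>A\<^esub> (mv_join A (\<sim>\<^bsub>A\<^esub> x) (\<sim>\<^bsub>A\<^esub> y))"

definition mv_le :: "'a mv \<Rightarrow> 'a \<Rightarrow> 'a \<Rightarrow> bool"
  where "mv_le A x y \<longleftrightarrow> mv_join A x y = y"

primrec mv_mult :: "'a mv \<Rightarrow> nat \<Rightarrow> 'a \<Rightarrow> 'a" where
  "mv_mult A 0 x = \<zero>\<^bsub>A\<^esub>"
| "mv_mult A (Suc n) x = x \<oplus>\<^bsub>A\<^esub> mv_mult A n x"

definition mv_order :: "'a mv \<Rightarrow> 'a \<Rightarrow> enat" where
  "mv_order A x =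
    (if \<exists>n. mv_mult A n x = \<one>\<^bsub>A\<^esub> then enat (LEAST n. mv_mult A n x = \<one>\<^bsub>A\<^esub>) else \<infinity>)"

definition perfect_mv :: "'a mv \<Rightarrow> bool" where
  "perfect_mv A \<longleftrightarrow> mv_algebra A \<and>
    (\<forall>x \<in> carrier A. (mv_order A x \<noteq> \<infinity>) \<noteq> (mv_order A (\<sim>\<^bsub>A\<^esub> x) \<noteq> \<infinity>))"


section \<open>Ideals and quotients\<close>

definition mv_ideal :: "'a mv \<Rightarrow> 'a set \<Rightarrow> bool" where
  "mv_ideal A J \<longleftrightarrow> J \<subseteq> carrier A \<and> J \<noteq> {} \<and>
    (\<forall>y \<in> J. \<forall>x \<in> carrier A. mv_le A x y \<longrightarrow> x \<in> J) \<and>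
    (\<forall>x \<in> J. \<forall>y \<in> J. x \<oplus>\<^bsub>A\<^esub> y \<in> J)"

definition prime_mv_ideal :: "'a mv \<Rightarrow> 'a set \<Rightarrow> bool" where
  "prime_mv_ideal A P \<longleftrightarrow> mv_ideal A P \<and> P \<noteq> carrier A \<and>
    (\<forall>x \<in> carrier A. \<forall>y \<in> carrier A. mv_meet A x y \<in> P \<longrightarrow> x \<in> P \<or> y \<in> P)"

definition Spec :: "'a mv \<Rightarrow> 'a set set"
  where "Spec A = {P. prime_mv_ideal A P}"

definition maximal_mv_ideal :: "'a mv \<Rightarrow> 'a set \<Rightarrow> bool" where
  "maximal_mv_ideal A M \<longleftrightarrow> mv_ideal A M \<and> M \<noteq> carrier A \<and>
    (\<forall>J. mv_ideal A J \<and> J \<noteq> carrier A \<and> M \<subseteq> J \<longrightarrow> J = M)"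

text \<open>Quotient by an equivalence relation \<open>R\<close> on the carrier; meaningful only if \<open>R\<close> is
  compatible with the operations.\<close>

definition mv_mod :: "'a mv \<Rightarrow> ('a \<times> 'a) set \<Rightarrow> 'a set mv" where
  "mv_mod A R = \<lparr>
    carrier = carrier A // R,
    oplus = (\<lambda>X Y. \<Union>x \<in> X. \<Union>y \<in> Y. R `` {x \<oplus>\<^bsub>A\<^esub> y}),
    zero = R `` {\<zero>\<^bsub>A\<^esub>},
    neg = (\<lambda>X. \<Union>x \<in> X. R `` {\<sim>\<^bsub>A\<^esub> x})\<rparr>"

text \<open>Chang's distance: the sum of the two truncated differences, the difference of \<open>x\<close> and \<open>y\<close>
  being \<open>\<sim> (\<sim> x \<oplus> y)\<close>.\<close>

definition mv_dist :: "'a mv \<Rightarrow> 'a \<Rightarrow> 'a \<Rightarrow> 'a" where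
  "mv_dist A x y =
    \<sim>\<^bsub>A\<^esub> (\<sim>\<^bsub>A\<^esub> x \<oplus>\<^bsub>A\<^esub> y) \<oplus>\<^bsub>A\<^esub> \<sim>\<^bsub>A\<^esub> (\<sim>\<^bsub>A\<^esub> y \<oplus>\<^bsub>A\<^esub> x)"

definition ideal_cong :: "'a mv \<Rightarrow> 'a set \<Rightarrow> ('a \<times> 'a) set" where
  "ideal_cong A J = {(x, y). x \<in> carrier A \<and> y \<in> carrier A \<and> mv_dist A x y \<in> J}"

definition mv_quot :: "'a mv \<Rightarrow> 'a set \<Rightarrow> 'a set mv"
  where "mv_quot A J = mv_mod A (ideal_cong A J)"

definition perfect_mv_ideal :: "'a mv \<Rightarrow> 'a set \<Rightarrow> bool"
  where "perfect_mv_ideal A J \<longleftrightarrow> mv_ideal A J \<and> perfect_mv (mv_quot A J)"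

definition supermaximal_mv_ideal :: "'a mv \<Rightarrow> 'a set \<Rightarrow> bool" where
  "supermaximal_mv_ideal A M \<longleftrightarrow> maximal_mv_ideal A M \<and>
    carrier (mv_quot A M) = {\<zero>\<^bsub>mv_quot A M\<^esub>, \<one>\<^bsub>mv_quot A M\<^esub>}"


section \<open>Terms and free MV-algebras\<close>

datatype (vars: 'k) mv_term =
  Var 'k | Zero | Plus "'k mv_term" "'k mv_term" | Neg "'k mv_term"

primrec mv_eval :: "'a mv \<Rightarrow> ('k \<Rightarrow> 'a) \<Rightarrow> 'k mv_term \<Rightarrow> 'a" where
  "mv_eval A v (Var k) = v k"
| "mv_eval A v Zero = \<zero>\<^bsub>A\<^esub>"
| "mv_eval A v (Plus s t) = mv_eval A v s \<oplus>\<^bsub>A\<^esub> mv_eval A v t"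
| "mv_eval A v (Neg t) = \<sim>\<^bsub>A\<^esub> mv_eval A v t"

definition term_algebra :: "'k set \<Rightarrow> 'k mv_term mv" where
  "term_algebra K = \<lparr>carrier = {t. vars t \<subseteq> K}, oplus = Plus, zero = Zero, neg = Neg\<rparr>"

text \<open>Provable equality: the least congruence on the term algebra that contains all instances of
  the MV-algebra axioms.\<close>

inductive_set provable_eq :: "'k set \<Rightarrow> ('k mv_term \<times> 'k mv_term) set" for K where
  refl: "vars t \<subseteq> K \<Longrightarrow> (t, t) \<in> provable_eq K"
| sym: "(s, t) \<in> provable_eq K \<Longrightarrow> (t, s) \<in> provable_eq K"
| trans: "(s, t) \<in> provable_eq K \<Longrightarrow> (t, u) \<in> provable_eq K \<Longrightarrow> (s, u) \<in> provable_eq K"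
| plus_cong: "(s, s') \<in> provable_eq K \<Longrightarrow> (t, t') \<in> provable_eq K
    \<Longrightarrow> (Plus s t, Plus s' t') \<in> provable_eq K"
| neg_cong: "(s, t) \<in> provable_eq K \<Longrightarrow> (Neg s, Neg t) \<in> provable_eq K"
| assoc: "vars s \<subseteq> K \<Longrightarrow> vars t \<subseteq> K \<Longrightarrow> vars u \<subseteq> K
    \<Longrightarrow> (Plus (Plus s t) u, Plus s (Plus t u)) \<in> provable_eq K"
| comm: "vars s \<subseteq> K \<Longrightarrow> vars t \<subseteq> K \<Longrightarrow> (Plus s t, Plus t s) \<in> provable_eq K"
| zero: "vars t \<subseteq> K \<Longrightarrow> (Plus t Zero, t) \<in> provable_eq K"
| neg_neg: "vars t \<subseteq> K \<Longrightarrow> (Neg (Neg t), t) \<in> provable_eq K"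
| neg_zero: "vars t \<subseteq> K \<Longrightarrow> (Plus t (Neg Zero), Neg Zero) \<in> provable_eq K"
| lukasiewicz: "vars s \<subseteq> K \<Longrightarrow> vars t \<subseteq> K
    \<Longrightarrow> (Plus (Neg (Plus (Neg s) t)) t, Plus (Neg (Plus (Neg t) s)) s) \<in> provable_eq K"

text \<open>The free MV-algebra on the set of generators \<open>K\<close>; the universal property is
  \<open>Free_universal\<close> below. The cardinal number of generators is the cardinality of \<open>K\<close>, which may
  be empty, finite or infinite.\<close>

definition Free :: "'k set \<Rightarrow> 'k mv_term set mv"
  where "Free K = mv_mod (term_algebra K) (provable_eq K)"

definition Free_gen :: "'k set \<Rightarrow> 'k \<Rightarrow> 'k mv_term set"
  where "Free_gen K k = provable_eq K `` {Var k}"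

definition Spec_above :: "'k set \<Rightarrow> 'k mv_term set set \<Rightarrow> 'k mv_term set set set"
  where "Spec_above K I = {P \<in> Spec (Free K). I \<subseteq> P}"


section \<open>The Chang algebra and the variety it generates\<close>

text \<open>On \<open>int \<times> int\<close> the order is lexicographic and addition is componentwise.\<close>

definition Chang :: "(int \<times> int) mv" where
  "Chang = \<lparr>
    carrier = {(0, 0)..(1, 0)},
    oplus = (\<lambda>a b. min (a + b) (1, 0)),
    zero = (0, 0),
    neg = (\<lambda>a. (1, 0) - a)\<rparr>"

text \<open>\<open>satisfies A (s, t)\<close> says that the identity \<open>s = t\<close> holds in \<open>A\<close>.\<close>

definition satisfies :: "'a mv \<Rightarrow> 'k mv_term \<times> 'k mv_term \<Rightarrow> bool" where
  "satisfies A = (\<lambda>(s, t). \<forall>v \<in> UNIV \<rightarrow> carrier A. mv_eval A v s = mv_eval A v t)"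

text \<open>\<open>in_variety B A\<close>: the algebra \<open>A\<close> lies in the variety of MV-algebras generated by \<open>B\<close>, i.e. in
  the smallest equational class containing \<open>B\<close>. Identities use countably many variables. For
  MV-algebras \<open>B\<close> this is the closure of \<open>B\<close> under products, subalgebras and homomorphic images; see
  \<open>in_variety_iff_HSP\<close> below.\<close>

definition in_variety :: "'b mv \<Rightarrow> 'a mv \<Rightarrow> bool" where
  "in_variety B A \<longleftrightarrow> mv_algebra A \<and>
    (\<forall>e :: nat mv_term \<times> nat mv_term. satisfies B e \<longrightarrow> satisfies A e)"


section \<open>Homomorphisms, subalgebras, powers\<close>

definition mv_hom :: "'a mv \<Rightarrow> 'b mv \<Rightarrow> ('a \<Rightarrow> 'b) set" where
  "mv_hom A B = {h. h \<in> carrier A \<rightarrow> carrier B \<and> h \<zero>\<^bsub>A\<^esub> = \<zero>\<^bsub>B\<^esub> \<and>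
    (\<forall>x \<in> carrier A. \<forall>y \<in> carrier A. h (x \<oplus>\<^bsub>A\<^esub> y) = h x \<oplus>\<^bsub>B\<^esub> h y) \<and>
    (\<forall>x \<in> carrier A. h (\<sim>\<^bsub>A\<^esub> x) = \<sim>\<^bsub>B\<^esub> h x)}"

definition mv_subuniverse :: "'a set \<Rightarrow> 'a mv \<Rightarrow> bool" where
  "mv_subuniverse S A \<longleftrightarrow> S \<subseteq> carrier A \<and> \<zero>\<^bsub>A\<^esub> \<in> S \<and>
    (\<forall>x \<in> S. \<forall>y \<in> S. x \<oplus>\<^bsub>A\<^esub> y \<in> S) \<and> (\<forall>x \<in> S. \<sim>\<^bsub>A\<^esub> x \<in> S)"

definition mv_power :: "'a mv \<Rightarrow> 'j set \<Rightarrow> ('j \<Rightarrow> 'a) mv" where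
  "mv_power A J = \<lparr>
    carrier = J \<rightarrow>\<^sub>E carrier A,
    oplus = (\<lambda>f g. \<lambda>j \<in> J. f j \<oplus>\<^bsub>A\<^esub> g j),
    zero = (\<lambda>j \<in> J. \<zero>\<^bsub>A\<^esub>),
    neg = (\<lambda>f. \<lambda>j \<in> J. \<sim>\<^bsub>A\<^esub> f j)\<rparr>"


section \<open>Consistency of the definitions\<close>

lemma mv_algebra_Chang: "mv_algebra Chang"
proof -
  have mn: "min (a, b) (1 :: int, 0 :: int) = (if a < 1 \<or> a = 1 \<and> b < 0 then (a, b) else (1, 0))"
    for a b by (auto simp: min_def less_eq_prod_def)
  have car: "(a, b) \<in> carrier Chang \<longleftrightarrow> a = 0 \<and> 0 \<le> b \<or> a = 1 \<and> b \<le> 0" for a b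
    by (auto simp: Chang_def less_eq_prod_def)
  have op: "(a, b) \<oplus>\<^bsub>Chang\<^esub> (c, d) =
      (if a + c < 1 \<or> a + c = 1 \<and> b + d < 0 then (a + c, b + d) else (1, 0))" for a b c d
    by (simp add: Chang_def mn)
  have ng: "\<sim>\<^bsub>Chang\<^esub> (a, b) = (1 - a, - b)" "\<zero>\<^bsub>Chang\<^esub> = (0, 0)" for a b
    by (simp_all add: Chang_def)
  have cases: "x \<in> carrier Chang \<Longrightarrow> \<exists>b \<ge> 0. x = (0, b) \<or> x = (1, - b)" for x
    by (cases x) (auto simp: car intro: exI[of _ "- snd x"])
  show ?thesis
    apply unfold_locales
    apply (simp add: car ng)
    apply (drule cases, drule cases, elim exE conjE disjE; simp add: op ng car)
    apply (drule cases, elim exE conjE disjE; simp add: op ng car)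
    apply (drule cases, drule cases, drule cases, elim exE conjE disjE; simp add: op ng car)
    apply (drule cases, drule cases, elim exE conjE disjE; simp add: op ng car)
    apply (drule cases, elim exE conjE disjE; simp add: op ng car)
    apply (drule cases, elim exE conjE disjE; simp add: op ng car)
    apply (drule cases, elim exE conjE disjE; simp add: op ng car)
    apply (drule cases, drule cases, elim exE conjE disjE; simp add: op ng car)
    done
qed

lemma (in mv_algebra) eval_closed:
  "(\<And>k. k \<in> vars t \<Longrightarrow> v k \<in> carrier A) \<Longrightarrow> mv_eval A v t \<in> carrier A"
  by (induction t) (auto intro: zero_closed oplus_closed neg_closed)

lemma mv_eval_cong: "(\<And>k. k \<in> vars t \<Longrightarrow> v k = w k) \<Longrightarrow> mv_eval A v t = mv_eval A w t"
  by (induction t) auto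

lemma mv_eval_map: "mv_eval A v (map_mv_term f t) = mv_eval A (v \<circ> f) t"
  by (induction t) auto

lemma provable_eq_vars: "(s, t) \<in> provable_eq K \<Longrightarrow> vars s \<subseteq> K \<and> vars t \<subseteq> K"
  by (induction rule: provable_eq.induct) auto

lemma equiv_provable_eq: "equiv {t. vars t \<subseteq> K} (provable_eq K)"
  by (intro equivI refl_onI symI transI)
    (auto dest: provable_eq_vars intro: provable_eq.refl provable_eq.sym provable_eq.trans)

lemma (in mv_algebra) provable_eq_sound:
  "(s, t) \<in> provable_eq K \<Longrightarrow> v \<in> K \<rightarrow> carrier A \<Longrightarrow> mv_eval A v s = mv_eval A v t"
proof (induction rule: provable_eq.induct)
  case (assoc s t u)
  then have "mv_eval A v s \<in> carrier A" "mv_eval A v t \<in> carrier A" "mv_eval A v u \<in> carrier A"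
    by (auto intro!: eval_closed)
  then show ?case by (simp add: oplus_assoc)
next
  case (comm s t)
  then have "mv_eval A v s \<in> carrier A" "mv_eval A v t \<in> carrier A"
    by (auto intro!: eval_closed)
  then show ?case by (simp add: oplus_comm)
next
  case (zero t)
  then have "mv_eval A v t \<in> carrier A" by (auto intro!: eval_closed)
  then show ?case by (simp add: oplus_zero)
next
  case (neg_neg t)
  then have "mv_eval A v t \<in> carrier A" by (auto intro!: eval_closed)
  then show ?case by (simp add: mv_algebra.neg_neg[OF mv_algebra_axioms])
next
  case (neg_zero t)
  then have "mv_eval A v t \<in> carrier A" by (auto intro!: eval_closed)
  then show ?case by (simp add: oplus_neg_zero)
next
  case (lukasiewicz s t)
  then have "mv_eval A v s \<in> carrier A" "mv_eval A v t \<in> carrier A"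
    by (auto intro!: eval_closed)
  then show ?case by (simp add: mv_algebra.lukasiewicz[OF mv_algebra_axioms])
qed auto

lemma Free_simps:
  "carrier (Free K) = {provable_eq K `` {t} | t. vars t \<subseteq> K}"
  "zero (Free K) = provable_eq K `` {Zero}"
  "vars s \<subseteq> K \<Longrightarrow> vars t \<subseteq> K \<Longrightarrow>
    oplus (Free K) (provable_eq K `` {s}) (provable_eq K `` {t}) = provable_eq K `` {Plus s t}"
  "vars t \<subseteq> K \<Longrightarrow> neg (Free K) (provable_eq K `` {t}) = provable_eq K `` {Neg t}"
proof -
  have E: "equiv {t. vars t \<subseteq> K} (provable_eq K)" by (rule equiv_provable_eq)
  show "carrier (Free K) = {provable_eq K `` {t} | t. vars t \<subseteq> K}"
    by (auto simp: Free_def mv_mod_def term_algebra_def quotient_def)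
  show "zero (Free K) = provable_eq K `` {Zero}"
    by (simp add: Free_def mv_mod_def term_algebra_def)
  show "oplus (Free K) (provable_eq K `` {s}) (provable_eq K `` {t}) = provable_eq K `` {Plus s t}"
    if "vars s \<subseteq> K" "vars t \<subseteq> K"
  proof -
    have "(\<lambda>s t. provable_eq K `` {Plus s t}) respects2 provable_eq K"
      by (intro congruent2I'[where ?r1.0="provable_eq K" and ?r2.0="provable_eq K"] equiv_class_eq[OF E])
        (auto intro: provable_eq.plus_cong)
    from UN_equiv_class2[OF E E this, of s t] that show ?thesis
      by (simp add: Free_def mv_mod_def term_algebra_def)
  qed
  show "neg (Free K) (provable_eq K `` {t}) = provable_eq K `` {Neg t}" if "vars t \<subseteq> K"
  proof -
    have "(\<lambda>t. provable_eq K `` {Neg t}) respects provable_eq K"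
      by (intro congruentI equiv_class_eq[OF E]) (auto intro: provable_eq.neg_cong)
    from UN_equiv_class[OF E this, of t] that show ?thesis
      by (simp add: Free_def mv_mod_def term_algebra_def)
  qed
qed

lemma mv_algebra_Free: "mv_algebra (Free K)"
proof -
  note E = equiv_class_eq[OF equiv_provable_eq[of K]]
  have c: "x \<in> carrier (Free K) \<Longrightarrow> \<exists>t. x = provable_eq K `` {t} \<and> vars t \<subseteq> K" for x
    by (auto simp: Free_simps(1))
  have i: "vars t \<subseteq> K \<Longrightarrow> provable_eq K `` {t} \<in> carrier (Free K)" for t
    by (auto simp: Free_simps(1))
  show ?thesis
    apply unfold_locales
    apply (simp add: i Free_simps(2))
    apply (drule c, drule c, elim exE conjE, simp add: i Free_simps(2-))
    apply (drule c, elim exE conjE, simp add: i Free_simps(2-))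
    apply (drule c, drule c, drule c, elim exE conjE, simp add: Free_simps(2-) E[OF provable_eq.assoc])
    apply (drule c, drule c, elim exE conjE, simp add: Free_simps(2-) E[OF provable_eq.comm])
    apply (drule c, elim exE conjE, simp add: Free_simps(2-) E[OF provable_eq.zero])
    apply (drule c, elim exE conjE, simp add: Free_simps(2-) E[OF provable_eq.neg_neg])
    apply (drule c, elim exE conjE, simp add: Free_simps(2-) E[OF provable_eq.neg_zero])
    apply (drule c, drule c, elim exE conjE, simp add: Free_simps(2-), rule E[OF provable_eq.lukasiewicz], assumption+)
    done
qed

theorem Free_universal:
  assumes "mv_algebra B" and v: "v \<in> K \<rightarrow> carrier B"
  shows "\<exists>h \<in> mv_hom (Free K) B. (\<forall>k \<in> K. h (Free_gen K k) = v k) \<and>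
    (\<forall>g \<in> mv_hom (Free K) B. (\<forall>k \<in> K. g (Free_gen K k) = v k)
      \<longrightarrow> (\<forall>x \<in> carrier (Free K). g x = h x))"
proof -
  interpret B: mv_algebra B by fact
  define h where "h X = mv_eval B v (SOME t. t \<in> X)" for X
  have h: "h (provable_eq K `` {t}) = mv_eval B v t" if "vars t \<subseteq> K" for t
  proof -
    have "t \<in> provable_eq K `` {t}" using that by (auto intro: provable_eq.refl)
    then have "(SOME s. s \<in> provable_eq K `` {t}) \<in> provable_eq K `` {t}" by (rule someI)
    then have "(t, SOME s. s \<in> provable_eq K `` {t}) \<in> provable_eq K" by simp
    from B.provable_eq_sound[OF this v] show ?thesis by (simp add: h_def)
  qed
  have cl: "mv_eval B v t \<in> carrier B" if "vars t \<subseteq> K" for t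
    using that v by (auto intro!: B.eval_closed)
  have "h \<in> mv_hom (Free K) B"
    unfolding mv_hom_def by (auto simp: Free_simps h cl)
  moreover have "\<forall>k \<in> K. h (Free_gen K k) = v k" by (simp add: Free_gen_def h)
  moreover have "g x = h x"
    if g: "g \<in> mv_hom (Free K) B" "\<forall>k \<in> K. g (Free_gen K k) = v k" and x: "x \<in> carrier (Free K)"
    for g x
  proof -
    have gh: "g (provable_eq K `` {t}) = mv_eval B v t" if "vars t \<subseteq> K" for t
      using that
    proof (induction t)
      case (Var k)
      then show ?case using g(2) by (simp add: Free_gen_def)
    next
      case Zero
      then show ?case using g(1) by (simp add: mv_hom_def Free_simps)
    next
      case (Plus s t)
      then have "provable_eq K `` {s} \<in> carrier (Free K)" "provable_eq K `` {t} \<in> carrier (Free K)"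
        by (auto simp: Free_simps(1))
      then have "g (provable_eq K `` {s} \<oplus>\<^bsub>Free K\<^esub> provable_eq K `` {t})
          = g (provable_eq K `` {s}) \<oplus>\<^bsub>B\<^esub> g (provable_eq K `` {t})"
        using g(1) by (simp add: mv_hom_def)
      then show ?case using Plus by (simp add: Free_simps)
    next
      case (Neg t)
      then have "provable_eq K `` {t} \<in> carrier (Free K)" by (auto simp: Free_simps(1))
      then have "g (\<sim>\<^bsub>Free K\<^esub> (provable_eq K `` {t})) = \<sim>\<^bsub>B\<^esub> g (provable_eq K `` {t})"
        using g(1) by (simp add: mv_hom_def)
      then show ?case using Neg by (simp add: Free_simps)
    qed
    from x show ?thesis by (auto simp: Free_simps(1) gh h)
  qed
  ultimately show ?thesis by blast
qed

lemma mv_hom_eval: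
  assumes "mv_algebra A" "h \<in> mv_hom A B" "v \<in> UNIV \<rightarrow> carrier A"
  shows "h (mv_eval A v t) = mv_eval B (h \<circ> v) t"
proof -
  interpret mv_algebra A by fact
  have "mv_eval A v t \<in> carrier A" for t using assms(3) by (auto intro!: eval_closed)
  then show ?thesis using assms(2) by (induction t) (auto simp: mv_hom_def)
qed

lemma mv_algebra_subpower:
  assumes "mv_algebra B" "mv_subuniverse S (mv_power B J)"
  shows "mv_algebra (mv_power B J\<lparr>carrier := S\<rparr>)"
proof -
  interpret B: mv_algebra B by fact
  have S: "f j \<in> carrier B" if "f \<in> S" "j \<in> J" for f j
    using that assms(2) by (auto simp: mv_subuniverse_def mv_power_def)
  have ext: "f \<in> extensional J" if "f \<in> S" for f
    using that assms(2) by (auto simp: mv_subuniverse_def mv_power_def PiE_def)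
  show ?thesis
    using assms(2)
    by unfold_locales
      (auto simp: mv_subuniverse_def mv_power_def S ext
        B.oplus_assoc B.oplus_zero B.neg_neg B.oplus_neg_zero B.zero_closed B.oplus_closed B.neg_closed
        intro!: extensionalityI[of _ J] B.oplus_comm B.lukasiewicz)
qed

text \<open>Birkhoff's theorem for a single generating algebra, as a check on \<open>in_variety\<close>. The index
  type of the power is large enough for every algebra on the type of \<open>A\<close>.\<close>

theorem in_variety_iff_HSP:
  fixes A :: "'a mv" and B :: "'b mv"
  assumes B: "mv_algebra B"
  shows "in_variety B A \<longleftrightarrow> mv_algebra A \<and>
    (\<exists>(J :: ('a \<Rightarrow> 'b) set) S h. mv_subuniverse S (mv_power B J) \<and>
      h \<in> mv_hom (mv_power B J\<lparr>carrier := S\<rparr>) A \<and> h ` S = carrier A)"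
    (is "_ \<longleftrightarrow> _ \<and> ?HSP")
proof (intro iffI conjI)
  assume "in_variety B A"
  then show A: "mv_algebra A" by (simp add: in_variety_def)
  interpret A: mv_algebra A by fact
  interpret B: mv_algebra B by fact
  define J where "J = (UNIV \<rightarrow> carrier B :: ('a \<Rightarrow> 'b) set)"
  define T where "T = {t :: 'a mv_term. vars t \<subseteq> carrier A}"
  define F where "F t = (\<lambda>v \<in> J. mv_eval B v t)" for t :: "'a mv_term"
  define h where "h f = mv_eval A (\<lambda>x. x) (SOME t. t \<in> T \<and> F t = f)" for f
  have eq: "mv_eval A (\<lambda>x. x) s = mv_eval A (\<lambda>x. x) t" if "s \<in> T" "t \<in> T" "F s = F t" for s t
  proof -
    let ?X = "vars s \<union> vars t"
    have "finite ?X" by (induction s; induction t) auto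
    then obtain r :: "'a \<Rightarrow> nat" where r: "inj_on r ?X"
      using finite_imp_inj_to_nat_seg by metis
    have "satisfies B (map_mv_term r s, map_mv_term r t)"
      unfolding satisfies_def
    proof clarify
      fix v :: "nat \<Rightarrow> 'b" assume "v \<in> UNIV \<rightarrow> carrier B"
      then have "v \<circ> r \<in> J" by (auto simp: J_def)
      with \<open>F s = F t\<close> have "mv_eval B (v \<circ> r) s = mv_eval B (v \<circ> r) t"
        unfolding F_def by (metis restrict_apply')
      then show "mv_eval B v (map_mv_term r s) = mv_eval B v (map_mv_term r t)"
        by (simp add: mv_eval_map)
    qed
    with \<open>in_variety B A\<close> have sat: "satisfies A (map_mv_term r s, map_mv_term r t)"
      by (simp add: in_variety_def)
    define w where "w n = (if n \<in> r ` ?X then inv_into ?X r n else \<zero>\<^bsub>A\<^esub>)" for n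
    have "inv_into ?X r n \<in> carrier A" if "n \<in> r ` ?X" for n
      using inv_into_into[OF that] \<open>s \<in> T\<close> \<open>t \<in> T\<close> by (auto simp: T_def)
    then have "w \<in> UNIV \<rightarrow> carrier A" by (auto simp: w_def A.zero_closed)
    with sat have "mv_eval A (w \<circ> r) s = mv_eval A (w \<circ> r) t"
      by (auto simp: satisfies_def mv_eval_map)
    moreover have wr: "(w \<circ> r) x = x" if "x \<in> ?X" for x
      using that r by (auto simp: w_def inv_into_f_f)
    have "mv_eval A (w \<circ> r) s = mv_eval A (\<lambda>x. x) s" "mv_eval A (w \<circ> r) t = mv_eval A (\<lambda>x. x) t"
      by (intro mv_eval_cong wr; simp)+
    ultimately show ?thesis by simp
  qed
  have h: "h (F t) = mv_eval A (\<lambda>x. x) t" if "t \<in> T" for t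
  proof -
    have "\<exists>s. s \<in> T \<and> F s = F t" using that by blast
    from someI_ex[OF this] show ?thesis unfolding h_def using that by (intro eq) auto
  qed
  have F: "oplus (mv_power B J) (F s) (F t) = F (Plus s t)" "neg (mv_power B J) (F t) = F (Neg t)"
    "zero (mv_power B J) = F Zero" for s t
    by (auto simp: mv_power_def F_def fun_eq_iff)
  have T: "Zero \<in> T" "s \<in> T \<Longrightarrow> t \<in> T \<Longrightarrow> Plus s t \<in> T" "t \<in> T \<Longrightarrow> Neg t \<in> T" for s t
    by (auto simp: T_def)
  have "F t \<in> carrier (mv_power B J)" for t
    by (auto simp: F_def mv_power_def J_def intro!: B.eval_closed)
  then have "mv_subuniverse (F ` T) (mv_power B J)"
    unfolding mv_subuniverse_def by (auto simp: F T)
  moreover have cl: "mv_eval A (\<lambda>x. x) t \<in> carrier A" if "t \<in> T" for t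
    using that by (auto simp: T_def intro!: A.eval_closed)
  then have "h \<in> mv_hom (mv_power B J\<lparr>carrier := F ` T\<rparr>) A"
    unfolding mv_hom_def by (auto simp: F T h)
  moreover have "h ` F ` T = carrier A"
  proof
    show "h ` F ` T \<subseteq> carrier A" using cl h by auto
    show "carrier A \<subseteq> h ` F ` T"
    proof
      fix x assume "x \<in> carrier A"
      then have "Var x \<in> T" by (simp add: T_def)
      then have "h (F (Var x)) = x" by (simp add: h)
      then show "x \<in> h ` F ` T" using \<open>Var x \<in> T\<close> by (metis image_eqI)
    qed
  qed
  ultimately show ?HSP by blast
next
  assume R: "mv_algebra A \<and> ?HSP"
  then obtain J :: "('a \<Rightarrow> 'b) set" and S h where S: "mv_subuniverse S (mv_power B J)"
    and h: "h \<in> mv_hom (mv_power B J\<lparr>carrier := S\<rparr>) A" "h ` S = carrier A" by blast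
  let ?P = "mv_power B J\<lparr>carrier := S\<rparr>"
  have P: "mv_algebra ?P" by (rule mv_algebra_subpower[OF B S])
  interpret P: mv_algebra ?P by (rule P)
  have "satisfies A (s, t)" if st: "satisfies B (s, t)" for s t :: "nat mv_term"
    unfolding satisfies_def
  proof clarify
    fix v :: "nat \<Rightarrow> 'a" assume v: "v \<in> UNIV \<rightarrow> carrier A"
    define u where "u n = inv_into S h (v n)" for n :: nat
    have vS: "v n \<in> h ` S" for n using v h(2) by auto
    have u: "u \<in> UNIV \<rightarrow> carrier ?P" using inv_into_into[OF vS] by (auto simp: u_def)
    have hu: "h \<circ> u = v" by (auto simp: u_def f_inv_into_f[OF vS])
    have uj: "(\<lambda>n. u n j) \<in> UNIV \<rightarrow> carrier B" if "j \<in> J" for j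
      using u S that by (auto simp: mv_subuniverse_def mv_power_def)
    have ev: "mv_eval ?P u r j = mv_eval B (\<lambda>n. u n j) r" if "j \<in> J" for r j
      using that by (induction r) (auto simp: mv_power_def)
    have ext: "mv_eval ?P u r \<in> extensional J" for r
    proof -
      have "mv_eval ?P u r \<in> carrier ?P" using u by (intro P.eval_closed) auto
      then show ?thesis using S by (auto simp: mv_subuniverse_def mv_power_def PiE_def)
    qed
    have "mv_eval ?P u s = mv_eval ?P u t"
      using st uj by (intro extensionalityI[OF ext ext]) (auto simp: ev satisfies_def)
    then show "mv_eval A v s = mv_eval A v t"
      using mv_hom_eval[OF P h(1) u] unfolding hu by metis
  qed
  then show "in_variety B A" using R by (auto simp: in_variety_def)
qed

end

theory Submission
  imports Defs "HOL-Library.Function_Algebras"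
begin

text \<open>
  Except for membership in the variety, the conditions are statements about ideals, and their equivalence rests on one
  translation: an element \<open>x\<close> has finite order modulo \<open>J\<close> iff some \<open>\<sim> (n
  x)\<close> lies in \<open>J\<close>, and it has infinite order modulo a proper ideal \<open>J\<close> iff
  \<open>J\<close> and \<open>x\<close> lie in a common proper ideal. Hence a prime ideal \<open>P\<close> is perfect
  as soon as the maximal ideals above \<open>P\<close> are supermaximal: such an ideal contains \<open>x\<close> or
  \<open>\<sim> x\<close>, so at least one of the two has infinite order modulo \<open>P\<close>; and since
  \<open>P\<close> is prime, the larger of the two dominates the other modulo \<open>P\<close>, so it cannot have
  infinite order as well without putting both into one proper ideal. Conversely, maximal ideals are prime, and modulo
  a maximal ideal an element of infinite order is zero, so a perfect maximal ideal is supermaximal. Finally, primes of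
  a quotient \<open>F/I\<close> are the primes of \<open>F\<close> above \<open>I\<close>, and perfection of an ideal
  is a condition on its preimage.

  Membership in the variety makes maximal ideals supermaximal because the Chang algebra satisfies the identity
  \<open>2 x\<^sup>2 = (2 x)\<^sup>2\<close>, with \<open>x\<^sup>2 = \<sim> (\<sim> x \<oplus> \<sim> x)\<close>. Put
  \<open>y = x \<and> \<sim> x\<close>. Then \<open>y\<^sup>2 = 0\<close>, and by the identity all \<open>2\<^sup>n
  y\<close> have square zero. Such elements have infinite order modulo every proper ideal, so \<open>y\<close> lies in
  every maximal ideal, and with it \<open>x\<close> or \<open>\<sim> x\<close>.

  The substantial implication leads from perfect primes to membership in the variety. The prime ideals of
  \<open>A\<close> intersect in zero, so an identity may be checked in the quotients \<open>A/P\<close>, which are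
  perfect chains. In a perfect chain \<open>B\<close> every element is infinitesimal or the negation of an
  infinitesimal, and the infinitesimals form the positive cone of a totally ordered abelian group \<open>G\<close>; in
  effect \<open>B = \<Gamma>(\<int> lex G, (1,0))\<close>, whereas the Chang algebra is \<open>\<Gamma>(\<int> lex
  \<int>, (1,0))\<close>. Evaluating two terms in \<open>B\<close> compares only finitely many integer linear
  combinations of finitely many elements of \<open>G\<close> with zero. By Fourier-Motzkin elimination
  (\<open>total_cone_sign_realization\<close>) some integers in place of these elements give exactly the same
  outcomes. So an identity that fails in \<open>B\<close> fails in the Chang algebra.

  The group \<open>G\<close> is never constructed. It is replaced by the set of integer vectors that are nonnegative
  at the given elements, a total cone in \<open>\<int>\<^sup>n\<close>; \<open>represents\<close> links such vectors
  with infinitesimals, and \<open>sym_eval\<close> evaluates terms symbolically by vectors, so that \<open>B\<close>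
  and the Chang algebra are two readings of the same computation.
\<close>

section \<open>Arithmetic in MV-algebras\<close>

text \<open>
  The truncated difference: \<open>max (x - y) 0\<close> in an interval of an ordered group.
\<close>

definition mv_diff :: "'a mv \<Rightarrow> 'a \<Rightarrow> 'a \<Rightarrow> 'a"
  where "mv_diff A x y = \<sim>\<^bsub>A\<^esub> (\<sim>\<^bsub>A\<^esub> x \<oplus>\<^bsub>A\<^esub> y)"

context mv_algebra
begin

abbreviation le (infix "\<sqsubseteq>" 50) where "x \<sqsubseteq> y \<equiv> mv_le A x y"
abbreviation diff (infixl "\<ominus>" 65) where "x \<ominus> y \<equiv> mv_diff A x y"

declare zero_closed [simp, intro] oplus_closed [simp, intro] neg_closed [simp, intro]
  oplus_zero [simp] neg_neg [simp]

lemma one_closed [simp, intro]: "\<one> \<in> carrier A"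
  by (simp add: mv_one_def)

lemma diff_closed [simp, intro]: "x \<in> carrier A \<Longrightarrow> y \<in> carrier A \<Longrightarrow> x \<ominus> y \<in> carrier A"
  by (simp add: mv_diff_def)

lemma join_closed [simp, intro]: "x \<in> carrier A \<Longrightarrow> y \<in> carrier A \<Longrightarrow> mv_join A x y \<in> carrier A"
  by (simp add: mv_join_def)

lemma meet_closed [simp, intro]: "x \<in> carrier A \<Longrightarrow> y \<in> carrier A \<Longrightarrow> mv_meet A x y \<in> carrier A"
  by (simp add: mv_meet_def)

lemma mult_closed [simp, intro]: "x \<in> carrier A \<Longrightarrow> mv_mult A n x \<in> carrier A"
  by (induction n) auto

lemma zero_oplus [simp]: "x \<in> carrier A \<Longrightarrow> \<zero> \<oplus> x = x"
  by (subst oplus_comm) auto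

lemma neg_zero [simp]: "\<sim> \<zero> = \<one>" and neg_one [simp]: "\<sim> \<one> = \<zero>"
  by (simp_all add: mv_one_def)

lemma oplus_one [simp]: "x \<in> carrier A \<Longrightarrow> x \<oplus> \<one> = \<one>"
  using oplus_neg_zero by simp

lemma one_oplus [simp]: "x \<in> carrier A \<Longrightarrow> \<one> \<oplus> x = \<one>"
  by (subst oplus_comm) auto

lemma neg_eq_iff: "x \<in> carrier A \<Longrightarrow> y \<in> carrier A \<Longrightarrow> \<sim> x = \<sim> y \<longleftrightarrow> x = y"
  by (metis neg_neg)

lemma oplus_left_commute:
  "x \<in> carrier A \<Longrightarrow> y \<in> carrier A \<Longrightarrow> z \<in> carrier A \<Longrightarrow> x \<oplus> (y \<oplus> z) = y \<oplus> (x \<oplus> z)"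
  by (metis oplus_assoc oplus_comm)

lemmas oplus_ac = oplus_assoc oplus_comm oplus_left_commute

lemma neg_oplus [simp]: "x \<in> carrier A \<Longrightarrow> \<sim> x \<oplus> x = \<one>"
  using lukasiewicz[of x \<one>] by simp

lemma oplus_neg [simp]: "x \<in> carrier A \<Longrightarrow> x \<oplus> \<sim> x = \<one>"
  by (subst oplus_comm) auto

lemma le_iff:
  assumes "x \<in> carrier A" "y \<in> carrier A"
  shows "x \<sqsubseteq> y \<longleftrightarrow> \<sim> x \<oplus> y = \<one>"
proof
  assume "x \<sqsubseteq> y"
  then have "\<sim> (\<sim> x \<oplus> y) \<oplus> y = y" by (simp add: mv_le_def mv_join_def)
  then have "\<sim> x \<oplus> y = \<sim> x \<oplus> (\<sim> (\<sim> x \<oplus> y) \<oplus> y)" by simp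
  also have "\<dots> = \<sim> (\<sim> x \<oplus> y) \<oplus> (\<sim> x \<oplus> y)" using assms by (simp add: oplus_left_commute)
  also have "\<dots> = \<one>" using assms by simp
  finally show "\<sim> x \<oplus> y = \<one>" .
next
  assume "\<sim> x \<oplus> y = \<one>"
  then show "x \<sqsubseteq> y" using assms by (simp add: mv_le_def mv_join_def)
qed

lemma le_refl [simp]: "x \<in> carrier A \<Longrightarrow> x \<sqsubseteq> x"
  by (simp add: le_iff)

lemma zero_le [simp]: "x \<in> carrier A \<Longrightarrow> \<zero> \<sqsubseteq> x"
  by (simp add: le_iff)

lemma le_one [simp]: "x \<in> carrier A \<Longrightarrow> x \<sqsubseteq> \<one>"
  by (simp add: le_iff)

text \<open>
  Residuation: \<open>(\<lambda>x. x \<ominus> y)\<close> is left adjoint to \<open>(\<lambda>z. y \<oplus> z)\<close>. Since the order is given by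
  \<open>\<sim> x \<oplus> y = \<one>\<close>, this is just associativity; most inequalities below are consequences.
\<close>

lemma diff_le_iff:
  assumes "x \<in> carrier A" "y \<in> carrier A" "z \<in> carrier A"
  shows "x \<ominus> y \<sqsubseteq> z \<longleftrightarrow> x \<sqsubseteq> y \<oplus> z"
  using assms by (simp add: le_iff mv_diff_def oplus_assoc)

lemma diff_oplus: "x \<in> carrier A \<Longrightarrow> y \<in> carrier A \<Longrightarrow> (x \<ominus> y) \<oplus> y = (y \<ominus> x) \<oplus> x"
  using lukasiewicz by (simp add: mv_diff_def)

lemma join_eq: "mv_join A x y = (x \<ominus> y) \<oplus> y"
  by (simp add: mv_join_def mv_diff_def)

lemma le_iff_diff:
  assumes "x \<in> carrier A" "y \<in> carrier A"
  shows "x \<sqsubseteq> y \<longleftrightarrow> x \<ominus> y = \<zero>"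
  using assms neg_eq_iff[of "\<sim> x \<oplus> y" \<one>] by (simp add: le_iff mv_diff_def)

lemma le_antisym:
  assumes "x \<in> carrier A" "y \<in> carrier A" "x \<sqsubseteq> y" "y \<sqsubseteq> x"
  shows "x = y"
  using diff_oplus[of x y] assms by (simp add: le_iff_diff)

lemma le_oplus: "x \<in> carrier A \<Longrightarrow> y \<in> carrier A \<Longrightarrow> x \<sqsubseteq> y \<oplus> x"
  by (simp add: le_iff oplus_left_commute)

lemma le_oplus': "x \<in> carrier A \<Longrightarrow> y \<in> carrier A \<Longrightarrow> x \<sqsubseteq> x \<oplus> y"
  by (simp add: le_iff flip: oplus_assoc)

lemma le_trans:
  assumes x: "x \<in> carrier A" and y: "y \<in> carrier A" and z: "z \<in> carrier A"
    and xy: "x \<sqsubseteq> y" and yz: "y \<sqsubseteq> z"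
  shows "x \<sqsubseteq> z"
proof -
  \<comment> \<open>Both \<open>y = (y \<ominus> x) \<oplus> x\<close> and \<open>z = (z \<ominus> y) \<oplus> y\<close> hold, so \<open>x\<close> is a summand of \<open>z\<close>.\<close>
  have "y = (y \<ominus> x) \<oplus> x" using diff_oplus[OF x y] assms by (simp add: le_iff_diff)
  moreover have "z = (z \<ominus> y) \<oplus> y" using diff_oplus[OF y z] assms by (simp add: le_iff_diff)
  ultimately have "z = ((z \<ominus> y) \<oplus> (y \<ominus> x)) \<oplus> x"
    using x y z by (metis oplus_assoc diff_closed)
  then show ?thesis using x y z by (metis le_oplus oplus_closed diff_closed)
qed

lemma oplus_mono:
  assumes "x \<in> carrier A" "y \<in> carrier A" "z \<in> carrier A" "x \<sqsubseteq> y"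
  shows "z \<oplus> x \<sqsubseteq> z \<oplus> y"
proof -
  have eq: "y = (y \<ominus> x) \<oplus> x" using diff_oplus[of x y] assms by (simp add: le_iff_diff)
  have "z \<oplus> y = (y \<ominus> x) \<oplus> (z \<oplus> x)" using assms by (subst eq) (simp add: oplus_left_commute)
  then show ?thesis using assms by (simp add: le_oplus)
qed

lemma oplus_mono2:
  assumes "x \<in> carrier A" "y \<in> carrier A" "x' \<in> carrier A" "y' \<in> carrier A"
    and "x \<sqsubseteq> x'" "y \<sqsubseteq> y'"
  shows "x \<oplus> y \<sqsubseteq> x' \<oplus> y'"
  using le_trans[of "x \<oplus> y" "x \<oplus> y'" "x' \<oplus> y'"] oplus_mono[of y y' x] oplus_mono[of x x' y'] assms
  by (simp add: oplus_comm)

lemma neg_le_iff: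
  assumes "x \<in> carrier A" "y \<in> carrier A"
  shows "\<sim> x \<sqsubseteq> \<sim> y \<longleftrightarrow> y \<sqsubseteq> x"
  using assms by (simp add: le_iff oplus_comm)

lemma join_upper: "x \<in> carrier A \<Longrightarrow> y \<in> carrier A \<Longrightarrow> x \<sqsubseteq> mv_join A x y"
  "x \<in> carrier A \<Longrightarrow> y \<in> carrier A \<Longrightarrow> y \<sqsubseteq> mv_join A x y"
  unfolding join_eq by (subst diff_oplus, simp_all add: le_oplus)

lemma diff_mono:
  assumes "x \<in> carrier A" "y \<in> carrier A" "z \<in> carrier A" "x \<sqsubseteq> y"
  shows "x \<ominus> z \<sqsubseteq> y \<ominus> z"
  using assms by (simp add: mv_diff_def neg_le_iff oplus_mono oplus_comm[of _ z])

lemma join_least: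
  assumes "x \<in> carrier A" "y \<in> carrier A" "z \<in> carrier A" "x \<sqsubseteq> z" "y \<sqsubseteq> z"
  shows "mv_join A x y \<sqsubseteq> z"
proof -
  have "(x \<ominus> y) \<oplus> y \<sqsubseteq> (z \<ominus> y) \<oplus> y" using assms by (simp add: oplus_mono2 diff_mono)
  also have "(z \<ominus> y) \<oplus> y = z" using assms diff_oplus[of z y] by (simp add: le_iff_diff)
  finally show ?thesis by (simp add: join_eq)
qed

lemma meet_lower1: "x \<in> carrier A \<Longrightarrow> y \<in> carrier A \<Longrightarrow> mv_meet A x y \<sqsubseteq> x"
  and meet_lower2: "x \<in> carrier A \<Longrightarrow> y \<in> carrier A \<Longrightarrow> mv_meet A x y \<sqsubseteq> y"
  using join_upper[of "\<sim> x" "\<sim> y"] neg_le_iff[of "mv_join A (\<sim> x) (\<sim> y)" "\<sim> x"]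
    neg_le_iff[of "mv_join A (\<sim> x) (\<sim> y)" "\<sim> y"] by (simp_all add: mv_meet_def)

lemma meet_greatest:
  assumes "x \<in> carrier A" "y \<in> carrier A" "z \<in> carrier A" "z \<sqsubseteq> x" "z \<sqsubseteq> y"
  shows "z \<sqsubseteq> mv_meet A x y"
  using join_least[of "\<sim> x" "\<sim> y" "\<sim> z"] neg_le_iff[of "\<sim> z" "mv_join A (\<sim> x) (\<sim> y)"] assms
  by (simp add: mv_meet_def neg_le_iff)

lemma le_meet_iff:
  assumes "x \<in> carrier A" "y \<in> carrier A" "z \<in> carrier A"
  shows "z \<sqsubseteq> mv_meet A x y \<longleftrightarrow> z \<sqsubseteq> x \<and> z \<sqsubseteq> y"
  using assms by (meson meet_greatest meet_lower1 meet_lower2 le_trans meet_closed)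

lemma meet_comm: "x \<in> carrier A \<Longrightarrow> y \<in> carrier A \<Longrightarrow> mv_meet A x y = mv_meet A y x"
  by (intro le_antisym) (simp_all add: le_meet_iff meet_lower1 meet_lower2)

text \<open>
  A right adjoint preserves meets: this is distributivity of \<open>\<oplus>\<close> over \<open>\<and>\<close> in adjoint form.
\<close>

lemma le_oplus_meet:
  assumes "x \<in> carrier A" "y \<in> carrier A" "z \<in> carrier A" "u \<in> carrier A"
    and "u \<sqsubseteq> z \<oplus> x" "u \<sqsubseteq> z \<oplus> y"
  shows "u \<sqsubseteq> z \<oplus> mv_meet A x y"
  using assms by (simp add: le_meet_iff flip: diff_le_iff)

text \<open>
  If \<open>m\<close> is below \<open>x \<oplus> y\<close> and below \<open>z\<close>, then \<open>m \<ominus> x\<close> is below both \<open>y\<close> and \<open>z\<close>; residuating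
  back, \<open>m \<sqsubseteq> x \<oplus> (y \<and> z)\<close>. Also \<open>m \<sqsubseteq> z \<oplus> (y \<and> z)\<close>, and the two bounds combine. The lemma makes \<open>{u. u \<and> z \<in> P}\<close> an ideal when \<open>P\<close> is one.
\<close>

lemma meet_oplus_le:
  assumes x: "x \<in> carrier A" and y: "y \<in> carrier A" and z: "z \<in> carrier A"
  shows "mv_meet A (x \<oplus> y) z \<sqsubseteq> mv_meet A x z \<oplus> mv_meet A y z"
proof -
  let ?m = "mv_meet A (x \<oplus> y) z" and ?w = "mv_meet A y z"
  note c = x y z
  have m: "?m \<sqsubseteq> x \<oplus> y" "?m \<sqsubseteq> z" using c by (simp_all add: meet_lower1 meet_lower2)
  have "?m \<ominus> x \<sqsubseteq> y" using c m by (simp add: diff_le_iff)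
  moreover have "?m \<ominus> x \<sqsubseteq> z" using c m by (meson diff_le_iff le_oplus le_trans meet_closed oplus_closed)
  ultimately have 1: "?m \<sqsubseteq> x \<oplus> ?w" using c by (simp add: le_meet_iff flip: diff_le_iff)
  have "z \<sqsubseteq> z \<oplus> ?w" using c by (simp add: le_oplus')
  then have "?m \<sqsubseteq> z \<oplus> ?w" using c m le_trans[of ?m z "z \<oplus> ?w"] by simp
  with 1 have "?m \<sqsubseteq> ?w \<oplus> mv_meet A x z" using c by (intro le_oplus_meet) (simp_all add: oplus_comm)
  then show ?thesis using c by (simp add: oplus_comm)
qed

lemma meet_eq:
  assumes "x \<in> carrier A" "y \<in> carrier A"
  shows "mv_meet A x y = x \<ominus> (x \<ominus> y)"
proof -
  have "mv_join A (\<sim> x) (\<sim> y) = mv_join A (\<sim> y) (\<sim> x)"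
    using assms diff_oplus by (simp add: join_eq)
  then show ?thesis using assms by (simp add: mv_meet_def mv_diff_def mv_join_def oplus_comm)
qed

lemma diff_diff:
  assumes "x \<in> carrier A" "y \<in> carrier A" "z \<in> carrier A"
  shows "x \<ominus> y \<ominus> z = x \<ominus> (y \<oplus> z)"
  using assms by (simp add: mv_diff_def oplus_assoc)

lemma diff_le: "x \<in> carrier A \<Longrightarrow> y \<in> carrier A \<Longrightarrow> x \<ominus> y \<sqsubseteq> x"
  by (simp add: diff_le_iff le_oplus)

lemma diff_self [simp]: "x \<in> carrier A \<Longrightarrow> x \<ominus> x = \<zero>"
  by (simp add: mv_diff_def)

lemma le_zero_iff: "x \<in> carrier A \<Longrightarrow> x \<sqsubseteq> \<zero> \<longleftrightarrow> x = \<zero>"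
  by (auto intro: le_antisym)

text \<open>
  This turns quotients by prime ideals into chains. With the meet in the form \<open>x \<ominus> (x \<ominus> y)\<close> and the
  commutativity of the join \<open>(x \<ominus> y) \<oplus> y\<close>, subtractions are moved around until \<open>x\<close> is subtracted from
  something below \<open>x\<close>.
\<close>

lemma prelinear:
  assumes x: "x \<in> carrier A" and y: "y \<in> carrier A"
  shows "mv_meet A (x \<ominus> y) (y \<ominus> x) = \<zero>"
proof -
  note c [simp] = x y
  define w where "w = x \<ominus> (y \<ominus> x)"
  have w [simp]: "w \<in> carrier A" by (simp add: w_def)
  have "x \<ominus> y \<ominus> (y \<ominus> x) = w \<ominus> y" by (simp add: diff_diff oplus_comm w_def)
  then have "mv_meet A (x \<ominus> y) (y \<ominus> x) = x \<ominus> y \<ominus> (w \<ominus> y)" by (simp add: meet_eq)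
  also have "\<dots> = x \<ominus> ((w \<ominus> y) \<oplus> y)" by (simp add: diff_diff oplus_comm)
  also have "\<dots> = x \<ominus> w \<ominus> (y \<ominus> w)" 
    using diff_oplus[of w y] diff_diff[of x w "y \<ominus> w"] oplus_comm[of "y \<ominus> w" w] by simp
  also have "x \<ominus> w = mv_meet A x (y \<ominus> x)" by (simp add: meet_eq w_def)
  finally have "mv_meet A (x \<ominus> y) (y \<ominus> x) = mv_meet A x (y \<ominus> x) \<ominus> (y \<ominus> w)" .
  also have "\<dots> \<sqsubseteq> y \<ominus> x \<ominus> (y \<ominus> w)" by (simp add: diff_mono meet_lower2)
  also have "y \<ominus> x \<ominus> (y \<ominus> w) = mv_meet A y w \<ominus> x" by (simp add: diff_diff meet_eq oplus_comm)
  finally have 1: "mv_meet A (x \<ominus> y) (y \<ominus> x) \<sqsubseteq> mv_meet A y w \<ominus> x" .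
  have "mv_meet A y w \<sqsubseteq> x"
    using le_trans[of "mv_meet A y w" w x] by (simp add: meet_lower2 diff_le w_def)
  then have "mv_meet A y w \<ominus> x = \<zero>" by (simp add: le_iff_diff)
  then show ?thesis using 1 by (simp add: le_zero_iff)
qed

lemma one_diff [simp]: "x \<in> carrier A \<Longrightarrow> \<one> \<ominus> x = \<sim> x"
  and diff_one [simp]: "x \<in> carrier A \<Longrightarrow> x \<ominus> \<one> = \<zero>"
  and diff_zero [simp]: "x \<in> carrier A \<Longrightarrow> x \<ominus> \<zero> = x"
  and zero_diff [simp]: "x \<in> carrier A \<Longrightarrow> \<zero> \<ominus> x = \<zero>"
  by (simp_all add: mv_diff_def)

lemma neg_diff_neg:
  "x \<in> carrier A \<Longrightarrow> y \<in> carrier A \<Longrightarrow> \<sim> x \<ominus> \<sim> y = y \<ominus> x"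
  by (simp add: mv_diff_def oplus_comm)

lemma le_oplus_diff: "x \<in> carrier A \<Longrightarrow> y \<in> carrier A \<Longrightarrow> x \<sqsubseteq> y \<oplus> (x \<ominus> y)"
  by (simp flip: diff_le_iff)

lemma diff_triangle:
  assumes "x \<in> carrier A" "y \<in> carrier A" "z \<in> carrier A"
  shows "x \<ominus> z \<sqsubseteq> (x \<ominus> y) \<oplus> (y \<ominus> z)"
proof -
  have "x \<sqsubseteq> y \<oplus> (x \<ominus> y)" using assms by (simp add: le_oplus_diff)
  moreover have "y \<oplus> (x \<ominus> y) \<sqsubseteq> (z \<oplus> (y \<ominus> z)) \<oplus> (x \<ominus> y)"
    using assms by (intro oplus_mono2) (simp_all add: le_oplus_diff)
  ultimately have "x \<sqsubseteq> (z \<oplus> (y \<ominus> z)) \<oplus> (x \<ominus> y)"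
    using assms by (meson le_trans oplus_closed diff_closed)
  then show ?thesis using assms by (simp add: diff_le_iff oplus_ac)
qed

lemma oplus_diff_oplus_le:
  assumes "x \<in> carrier A" "y \<in> carrier A" "x' \<in> carrier A" "y' \<in> carrier A"
  shows "(x \<oplus> y) \<ominus> (x' \<oplus> y') \<sqsubseteq> (x \<ominus> x') \<oplus> (y \<ominus> y')"
proof -
  have "x \<oplus> y \<sqsubseteq> (x' \<oplus> (x \<ominus> x')) \<oplus> (y' \<oplus> (y \<ominus> y'))"
    using assms by (intro oplus_mono2) (simp_all add: le_oplus_diff)
  then show ?thesis using assms by (simp add: diff_le_iff oplus_ac)
qed

lemma mult_add: "x \<in> carrier A \<Longrightarrow> mv_mult A (m + n) x = mv_mult A m x \<oplus> mv_mult A n x"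
  by (induction m) (simp_all add: oplus_assoc)

lemma mult_mono: "x \<in> carrier A \<Longrightarrow> y \<in> carrier A \<Longrightarrow> x \<sqsubseteq> y \<Longrightarrow> mv_mult A n x \<sqsubseteq> mv_mult A n y"
  by (induction n) (simp_all add: oplus_mono2)

lemma one_le_iff: "x \<in> carrier A \<Longrightarrow> \<one> \<sqsubseteq> x \<longleftrightarrow> x = \<one>"
  by (auto intro: le_antisym)

section \<open>Ideals, quotients and homomorphisms\<close>

lemma ideal_subset: "mv_ideal A J \<Longrightarrow> x \<in> J \<Longrightarrow> x \<in> carrier A"
  and ideal_down: "mv_ideal A J \<Longrightarrow> y \<in> J \<Longrightarrow> x \<in> carrier A \<Longrightarrow> x \<sqsubseteq> y \<Longrightarrow> x \<in> J"
  and ideal_oplus: "mv_ideal A J \<Longrightarrow> x \<in> J \<Longrightarrow> y \<in> J \<Longrightarrow> x \<oplus> y \<in> J"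
  by (auto simp: mv_ideal_def)

lemma ideal_zero: "mv_ideal A J \<Longrightarrow> \<zero> \<in> J"
  unfolding mv_ideal_def by (metis zero_le zero_closed ex_in_conv subsetD)

lemma ideal_mult: "mv_ideal A J \<Longrightarrow> x \<in> J \<Longrightarrow> mv_mult A n x \<in> J"
  by (induction n) (auto simp: ideal_zero ideal_oplus)

lemma ideal_oplus_iff:
  "mv_ideal A J \<Longrightarrow> x \<in> carrier A \<Longrightarrow> y \<in> carrier A \<Longrightarrow> x \<oplus> y \<in> J \<longleftrightarrow> x \<in> J \<and> y \<in> J"
  by (meson ideal_down ideal_oplus le_oplus le_oplus' oplus_closed)

lemma ideal_proper_iff: "mv_ideal A J \<Longrightarrow> J \<noteq> carrier A \<longleftrightarrow> \<one> \<notin> J"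
  using ideal_down[of J \<one>] ideal_subset[of J] by (auto 4 3)

lemma ideal_proper_neg:
  "mv_ideal A J \<Longrightarrow> \<one> \<notin> J \<Longrightarrow> x \<in> carrier A \<Longrightarrow> x \<in> J \<Longrightarrow> \<sim> x \<notin> J"
  using ideal_oplus[of J x "\<sim> x"] by auto

lemma ideal_cong_iff:
  "mv_ideal A J \<Longrightarrow> (x, y) \<in> ideal_cong A J \<longleftrightarrow>
    x \<in> carrier A \<and> y \<in> carrier A \<and> x \<ominus> y \<in> J \<and> y \<ominus> x \<in> J"
  by (auto simp: ideal_cong_def mv_dist_def ideal_oplus_iff simp flip: mv_diff_def)

lemma ideal_diff_trans:
  assumes "mv_ideal A J" "x \<in> carrier A" "y \<in> carrier A" "z \<in> carrier A" "x \<ominus> y \<in> J" "y \<ominus> z \<in> J"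
  shows "x \<ominus> z \<in> J"
  using assms by (meson ideal_down ideal_oplus diff_triangle diff_closed)

lemma equiv_ideal_cong:
  assumes J: "mv_ideal A J"
  shows "equiv (carrier A) (ideal_cong A J)"
proof (intro equivI refl_onI symI transI)
  show "ideal_cong A J \<subseteq> carrier A \<times> carrier A" by (auto simp: ideal_cong_def)
qed (auto simp: ideal_cong_iff[OF J] ideal_zero[OF J] intro: ideal_diff_trans[OF J])

abbreviation cls :: "'a set \<Rightarrow> 'a \<Rightarrow> 'a set"
  where "cls J x \<equiv> ideal_cong A J `` {x}"

lemma cls_eq_iff:
  assumes "mv_ideal A J" "x \<in> carrier A" "y \<in> carrier A"
  shows "cls J x = cls J y \<longleftrightarrow> x \<ominus> y \<in> J \<and> y \<ominus> x \<in> J"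
  using assms eq_equiv_class_iff[OF equiv_ideal_cong] by (simp add: ideal_cong_iff)

lemma quot_carrier: "carrier (mv_quot A J) = cls J ` carrier A"
  by (auto simp: mv_quot_def mv_mod_def quotient_def)

lemma quot_zero: "zero (mv_quot A J) = cls J \<zero>"
  by (simp add: mv_quot_def mv_mod_def)

lemma quot_oplus:
  assumes J: "mv_ideal A J" and "x \<in> carrier A" "y \<in> carrier A"
  shows "oplus (mv_quot A J) (cls J x) (cls J y) = cls J (x \<oplus> y)"
proof -
  note E = equiv_ideal_cong[OF J]
  have "(x \<oplus> y) \<ominus> (x' \<oplus> y') \<in> J" if "x \<in> carrier A" "y \<in> carrier A" "x' \<in> carrier A" "y' \<in> carrier A"
    "x \<ominus> x' \<in> J" "y \<ominus> y' \<in> J" for x y x' y'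
    using ideal_down[OF J ideal_oplus[OF J that(5,6)]] oplus_diff_oplus_le that by simp
  then have "(\<lambda>x y. cls J (x \<oplus> y)) respects2 ideal_cong A J"
    by (intro congruent2I'[where ?r1.0="ideal_cong A J" and ?r2.0="ideal_cong A J"])
      (auto simp: ideal_cong_iff[OF J] cls_eq_iff[OF J])
  from UN_equiv_class2[OF E E this] assms show ?thesis
    by (simp add: mv_quot_def mv_mod_def)
qed

lemma quot_neg:
  assumes J: "mv_ideal A J" and "x \<in> carrier A"
  shows "neg (mv_quot A J) (cls J x) = cls J (\<sim> x)"
proof -
  note E = equiv_ideal_cong[OF J]
  have "(\<lambda>x. cls J (\<sim> x)) respects ideal_cong A J"
    by (intro congruentI) (auto simp: ideal_cong_iff[OF J] cls_eq_iff[OF J] neg_diff_neg)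
  from UN_equiv_class[OF E this] assms show ?thesis
    by (simp add: mv_quot_def mv_mod_def)
qed

lemma mv_algebra_quot:
  assumes J: "mv_ideal A J"
  shows "mv_algebra (mv_quot A J)"
proof (unfold_locales; unfold quot_carrier; (elim imageE)?)
  note ops = quot_zero quot_oplus[OF J] quot_neg[OF J]
  fix X Y x y assume X: "X = cls J x" "x \<in> carrier A" and Y: "Y = cls J y" "y \<in> carrier A"
  show "oplus (mv_quot A J) X Y = oplus (mv_quot A J) Y X"
    using oplus_comm[of x y] by (simp add: X Y ops)
  show "oplus (mv_quot A J) (neg (mv_quot A J) (oplus (mv_quot A J) (neg (mv_quot A J) X) Y)) Y =
      oplus (mv_quot A J) (neg (mv_quot A J) (oplus (mv_quot A J) (neg (mv_quot A J) Y) X)) X"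
    using lukasiewicz[of x y] by (simp add: X Y ops)
qed (simp_all add: quot_zero quot_oplus[OF J] quot_neg[OF J] oplus_assoc)

lemma cls_hom:
  assumes "mv_ideal A J"
  shows "cls J \<in> mv_hom A (mv_quot A J)"
  by (auto simp: mv_hom_def quot_carrier quot_zero quot_oplus[OF assms] quot_neg[OF assms])

end

lemma mv_hom_closed: "h \<in> mv_hom A B \<Longrightarrow> x \<in> carrier A \<Longrightarrow> h x \<in> carrier B"
  and mv_hom_zero: "h \<in> mv_hom A B \<Longrightarrow> h (zero A) = zero B"
  and mv_hom_oplus: "h \<in> mv_hom A B \<Longrightarrow> x \<in> carrier A \<Longrightarrow> y \<in> carrier A \<Longrightarrow>
    h (oplus A x y) = oplus B (h x) (h y)"
  and mv_hom_neg: "h \<in> mv_hom A B \<Longrightarrow> x \<in> carrier A \<Longrightarrow> h (neg A x) = neg B (h x)"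
  by (auto simp: mv_hom_def)

context mv_algebra
begin

lemma hom_one: "h \<in> mv_hom A B \<Longrightarrow> h \<one> = mv_one B"
  by (simp add: mv_one_def mv_hom_zero mv_hom_neg del: neg_zero)

lemma hom_diff: "h \<in> mv_hom A B \<Longrightarrow> x \<in> carrier A \<Longrightarrow> y \<in> carrier A \<Longrightarrow>
    h (x \<ominus> y) = mv_diff B (h x) (h y)"
  by (simp add: mv_diff_def mv_hom_oplus mv_hom_neg)

lemma hom_join: "h \<in> mv_hom A B \<Longrightarrow> x \<in> carrier A \<Longrightarrow> y \<in> carrier A \<Longrightarrow>
    h (mv_join A x y) = mv_join B (h x) (h y)"
  by (simp add: mv_join_def mv_hom_oplus mv_hom_neg)

lemma hom_meet: "h \<in> mv_hom A B \<Longrightarrow> x \<in> carrier A \<Longrightarrow> y \<in> carrier A \<Longrightarrow>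
    h (mv_meet A x y) = mv_meet B (h x) (h y)"
  by (simp add: mv_meet_def hom_join mv_hom_neg)

lemma hom_mult: "h \<in> mv_hom A B \<Longrightarrow> x \<in> carrier A \<Longrightarrow> h (mv_mult A n x) = mv_mult B n (h x)"
  by (induction n) (simp_all add: mv_hom_oplus mv_hom_zero)

lemma hom_le: "h \<in> mv_hom A B \<Longrightarrow> x \<in> carrier A \<Longrightarrow> y \<in> carrier A \<Longrightarrow> x \<sqsubseteq> y \<Longrightarrow> mv_le B (h x) (h y)"
  using hom_join[of h B x y] by (simp add: mv_le_def)

text \<open>
  Stated without the quotient algebra, perfection can be moved along homomorphisms and compared between
  ideals: \<open>n x\<close> becomes \<open>\<one>\<close> modulo \<open>J\<close> iff \<open>\<sim> (n x) \<in> J\<close>.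
\<close>

lemma perfect_ideal_iff:
  "perfect_mv_ideal A J \<longleftrightarrow> mv_ideal A J \<and> (\<forall>x \<in> carrier A.
    (\<exists>n. \<sim> (mv_mult A n x) \<in> J) \<noteq> (\<exists>n. \<sim> (mv_mult A n (\<sim> x)) \<in> J))"
proof (cases "mv_ideal A J")
  case J: True
  note h = cls_hom[OF J]
  have ord: "mv_order (mv_quot A J) (cls J x) = \<infinity> \<longleftrightarrow> \<not> (\<exists>n. \<sim> (mv_mult A n x) \<in> J)"
    if "x \<in> carrier A" for x
  proof -
    have "mv_mult (mv_quot A J) n (cls J x) = mv_one (mv_quot A J) \<longleftrightarrow> \<sim> (mv_mult A n x) \<in> J" for n
      using that by (simp add: cls_eq_iff[OF J] ideal_zero[OF J] flip: hom_mult[OF h] hom_one[OF h])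
    then show ?thesis by (simp add: mv_order_def)
  qed
  show ?thesis
    using J mv_algebra_quot[OF J] unfolding perfect_mv_ideal_def perfect_mv_def quot_carrier ball_simps
    by (intro conj_cong ball_cong) (simp_all add: quot_neg ord)
qed (simp add: perfect_mv_ideal_def)

lemma supermaximal_iff:
  assumes "maximal_mv_ideal A M"
  shows "supermaximal_mv_ideal A M \<longleftrightarrow> (\<forall>x \<in> carrier A. x \<in> M \<or> \<sim> x \<in> M)"
proof -
  have M: "mv_ideal A M" using assms by (simp add: maximal_mv_ideal_def)
  have "cls M x \<in> {cls M \<zero>, cls M \<one>} \<longleftrightarrow> x \<in> M \<or> \<sim> x \<in> M" if "x \<in> carrier A" for x
    using that by (simp add: cls_eq_iff[OF M] ideal_zero[OF M])
  then have "(\<forall>x \<in> carrier A. x \<in> M \<or> \<sim> x \<in> M) \<longleftrightarrow> cls M ` carrier A \<subseteq> {cls M \<zero>, cls M \<one>}"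
    by (simp add: image_subset_iff)
  also have "\<dots> \<longleftrightarrow> cls M ` carrier A = {cls M \<zero>, cls M \<one>}"
    by (auto simp only: set_eq_subset insert_subset empty_subsetI zero_closed one_closed imageI)
  finally show ?thesis
    using assms by (simp add: supermaximal_mv_ideal_def quot_carrier quot_zero flip: hom_one[OF cls_hom[OF M]])
qed

section \<open>Prime and maximal ideals\<close>

lemma ideal_meet_quotient:
  assumes P: "mv_ideal A P" and y: "y \<in> carrier A"
  shows "mv_ideal A {u \<in> carrier A. mv_meet A u y \<in> P}"
  unfolding mv_ideal_def
proof (intro conjI ballI impI)
  have "mv_meet A \<zero> y = \<zero>" using y by (simp add: le_zero_iff[symmetric] meet_lower1)
  then show "{u \<in> carrier A. mv_meet A u y \<in> P} \<noteq> {}" using ideal_zero[OF P] by auto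
next
  fix u v assume u: "u \<in> {u \<in> carrier A. mv_meet A u y \<in> P}" and v: "v \<in> carrier A" "v \<sqsubseteq> u"
  have "mv_meet A v y \<sqsubseteq> mv_meet A u y"
    using u v y le_trans[of "mv_meet A v y" v u] by (simp add: le_meet_iff meet_lower1 meet_lower2)
  then show "v \<in> {u \<in> carrier A. mv_meet A u y \<in> P}"
    using u v y ideal_down[OF P, of "mv_meet A u y" "mv_meet A v y"] by simp
next
  fix u v assume uv: "u \<in> {u \<in> carrier A. mv_meet A u y \<in> P}" "v \<in> {u \<in> carrier A. mv_meet A u y \<in> P}"
  then have "mv_meet A (u \<oplus> v) y \<in> P"
    using y meet_oplus_le[of u v y] ideal_oplus[OF P, of "mv_meet A u y" "mv_meet A v y"]
      ideal_down[OF P, of "mv_meet A u y \<oplus> mv_meet A v y" "mv_meet A (u \<oplus> v) y"] by simp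
  then show "u \<oplus> v \<in> {u \<in> carrier A. mv_meet A u y \<in> P}" using uv by simp
qed auto

text \<open>
  Let \<open>x \<and> y \<in> P\<close> with \<open>x, y \<notin> P\<close>. The ideal \<open>{u. u \<and> y \<in> P}\<close> properly contains \<open>P\<close>, so it contains
  \<open>d\<close>; hence \<open>{u. u \<and> d \<in> P}\<close> contains \<open>y\<close> and properly contains \<open>P\<close>, so it contains \<open>d\<close> too, which
  gives \<open>d = d \<and> d \<in> P\<close>. The case \<open>d = \<one>\<close> says that maximal ideals are prime, and general \<open>d\<close> gives
  enough primes to separate points.
\<close>

lemma maximal_avoiding_prime:
  assumes P: "mv_ideal A P" and d: "d \<in> carrier A" "d \<notin> P"
    and max: "\<And>Q. mv_ideal A Q \<Longrightarrow> P \<subseteq> Q \<Longrightarrow> d \<notin> Q \<Longrightarrow> Q = P"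
  shows "prime_mv_ideal A P"
proof -
  have *: "mv_meet A d y \<in> P" if "x \<in> carrier A" "y \<in> carrier A" "mv_meet A x y \<in> P" "x \<notin> P" for x y
  proof -
    let ?Q = "{u \<in> carrier A. mv_meet A u y \<in> P}"
    have "P \<subseteq> ?Q" using that ideal_subset[OF P] ideal_down[OF P _ _ meet_lower1] by auto
    moreover have "?Q \<noteq> P" using that by auto
    ultimately show ?thesis using max[OF ideal_meet_quotient[OF P that(2)]] by blast
  qed
  have "x \<in> P \<or> y \<in> P" if xy: "x \<in> carrier A" "y \<in> carrier A" "mv_meet A x y \<in> P" for x y
  proof (rule ccontr)
    assume "\<not> (x \<in> P \<or> y \<in> P)"
    then have "mv_meet A d y \<in> P" "y \<notin> P" using *[OF xy] by auto
    then have "mv_meet A d d \<in> P" using *[of y d] meet_comm[OF d(1) xy(2)] xy d by simp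
    then have "d \<in> P" using d ideal_down[OF P, of "mv_meet A d d" d] by (simp add: le_meet_iff)
    with d show False by simp
  qed
  then show ?thesis using P d by (auto simp: prime_mv_ideal_def)
qed

lemma exists_maximal_avoiding:
  assumes J: "mv_ideal A J" and d: "d \<notin> J"
  obtains P where "mv_ideal A P" "J \<subseteq> P" "d \<notin> P"
    "\<And>Q. mv_ideal A Q \<Longrightarrow> P \<subseteq> Q \<Longrightarrow> d \<notin> Q \<Longrightarrow> Q = P"
proof -
  let ?S = "{Q. mv_ideal A Q \<and> J \<subseteq> Q \<and> d \<notin> Q}"
  have "\<exists>P\<in>?S. \<forall>Q\<in>?S. P \<subseteq> Q \<longrightarrow> Q = P"
  proof (rule subset_Zorn_nonempty)
    show "?S \<noteq> {}" using J d by blast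
  next
    fix \<C> assume ne: "\<C> \<noteq> {}" and ch: "subset.chain ?S \<C>"
    then have S: "\<And>Q. Q \<in> \<C> \<Longrightarrow> mv_ideal A Q \<and> J \<subseteq> Q \<and> d \<notin> Q"
      and tot: "\<And>Q R. Q \<in> \<C> \<Longrightarrow> R \<in> \<C> \<Longrightarrow> Q \<subseteq> R \<or> R \<subseteq> Q"
      by (auto simp: subset_chain_def)
    have "mv_ideal A (\<Union>\<C>)"
      unfolding mv_ideal_def
    proof (intro conjI ballI impI)
      show "\<Union>\<C> \<subseteq> carrier A" using S ideal_subset by blast
      show "\<Union>\<C> \<noteq> {}" using S ne ideal_zero by blast
    next
      fix x y assume "y \<in> \<Union>\<C>" "x \<in> carrier A" "x \<sqsubseteq> y"
      then show "x \<in> \<Union>\<C>" using S ideal_down by blast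
    next
      fix x y assume "x \<in> \<Union>\<C>" "y \<in> \<Union>\<C>"
      then obtain Q R where "x \<in> Q" "y \<in> R" "Q \<in> \<C>" "R \<in> \<C>" by blast
      then show "x \<oplus> y \<in> \<Union>\<C>" using tot[of Q R] S ideal_oplus by blast
    qed
    then show "\<Union>\<C> \<in> ?S" using S ne by blast
  qed
  then show ?thesis using that by auto
qed

lemma maximal_ideal_prime: 
  assumes "maximal_mv_ideal A M"
  shows "prime_mv_ideal A M"
proof (rule maximal_avoiding_prime)
  show M: "mv_ideal A M" using assms by (simp add: maximal_mv_ideal_def)
  show "\<one> \<notin> M" using assms ideal_proper_iff[OF M] by (simp add: maximal_mv_ideal_def)
  show "Q = M" if "mv_ideal A Q" "M \<subseteq> Q" "\<one> \<notin> Q" for Q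
    using assms that ideal_proper_iff by (auto simp: maximal_mv_ideal_def)
qed simp

lemma exists_maximal_ideal:
  assumes "mv_ideal A J" "\<one> \<notin> J"
  obtains M where "maximal_mv_ideal A M" "J \<subseteq> M"
proof -
  obtain M where "mv_ideal A M" "J \<subseteq> M" "\<one> \<notin> M" "\<And>Q. mv_ideal A Q \<Longrightarrow> M \<subseteq> Q \<Longrightarrow> \<one> \<notin> Q \<Longrightarrow> Q = M"
    using exists_maximal_avoiding[OF assms] by blast
  then show ?thesis using that[of M] ideal_proper_iff unfolding maximal_mv_ideal_def by metis
qed

lemma exists_prime_avoiding:
  assumes "d \<in> carrier A" "d \<noteq> \<zero>"
  obtains P where "prime_mv_ideal A P" "d \<notin> P"
proof -
  have "mv_ideal A {\<zero>}" by (auto simp: mv_ideal_def le_zero_iff)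
  then show ?thesis
    using exists_maximal_avoiding[of "{\<zero>}" d] maximal_avoiding_prime[OF _ assms(1)] assms(2) that
    by (metis singletonD)
qed

text \<open>
  An element of infinite order modulo \<open>J\<close> can be added to \<open>J\<close>: the generated ideal consists of the
  elements below some \<open>p \<oplus> n x\<close> with \<open>p \<in> J\<close>, and \<open>\<one> \<sqsubseteq> p \<oplus> n x\<close> would give \<open>\<sim> (n x) \<sqsubseteq> p\<close>.
\<close>

lemma adjoin_ideal:
  assumes J: "mv_ideal A J" and x: "x \<in> carrier A" and inf: "\<And>n. \<sim> (mv_mult A n x) \<notin> J"
  obtains J' where "mv_ideal A J'" "J \<subseteq> J'" "x \<in> J'" "\<one> \<notin> J'"
proof
  let ?J = "{u \<in> carrier A. \<exists>p\<in>J. \<exists>n. u \<sqsubseteq> p \<oplus> mv_mult A n x}"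
  note sub = ideal_subset[OF J]
  show "mv_ideal A ?J"
    unfolding mv_ideal_def
  proof (intro conjI ballI impI)
    have "\<zero> \<in> ?J" using ideal_zero[OF J] x by (auto intro!: bexI[of _ \<zero>])
    then show "?J \<noteq> {}" by blast
  next
    fix u v assume u: "u \<in> ?J" and v: "v \<in> carrier A" "v \<sqsubseteq> u"
    then obtain p n where p: "p \<in> J" "u \<sqsubseteq> p \<oplus> mv_mult A n x" by blast
    then have "v \<sqsubseteq> p \<oplus> mv_mult A n x" using u v x sub by (blast intro: le_trans)
    then show "v \<in> ?J" using p v by blast
  next
    fix u v assume "u \<in> ?J" "v \<in> ?J"
    then obtain p m q n where *: "u \<in> carrier A" "v \<in> carrier A" "p \<in> J" "q \<in> J"
      "u \<sqsubseteq> p \<oplus> mv_mult A m x" "v \<sqsubseteq> q \<oplus> mv_mult A n x" by auto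
    then have "u \<oplus> v \<sqsubseteq> (p \<oplus> mv_mult A m x) \<oplus> (q \<oplus> mv_mult A n x)"
      using x sub by (intro oplus_mono2) auto
    also have "\<dots> = (p \<oplus> q) \<oplus> mv_mult A (m + n) x"
      using * x sub by (simp add: mult_add oplus_ac)
    finally show "u \<oplus> v \<in> ?J" using * ideal_oplus[OF J] by blast
  qed auto
  show "J \<subseteq> ?J" using x sub le_oplus'[of _ "mv_mult A 0 x"] by blast
  show "x \<in> ?J" using x ideal_zero[OF J] by (auto intro!: bexI[of _ \<zero>] exI[of _ 1])
  show "\<one> \<notin> ?J"
  proof
    assume "\<one> \<in> ?J"
    then obtain p n where p: "p \<in> J" "\<one> \<sqsubseteq> mv_mult A n x \<oplus> p"
      using x sub by (auto simp: oplus_comm)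
    then have "\<sim> (mv_mult A n x) \<sqsubseteq> p"
      using x sub by (simp flip: diff_le_iff)
    then show False using inf ideal_down[OF J p(1)] x by blast
  qed
qed

lemma prime_diff:
  assumes P: "prime_mv_ideal A P" and "x \<in> carrier A" "y \<in> carrier A"
  shows "x \<ominus> y \<in> P \<or> y \<ominus> x \<in> P"
proof -
  have "mv_meet A (x \<ominus> y) (y \<ominus> x) \<in> P" 
    using assms ideal_zero by (simp add: prelinear prime_mv_ideal_def)
  then show ?thesis using assms by (auto simp: prime_mv_ideal_def)
qed

section \<open>Supermaximal ideals and perfect primes\<close>

text \<open>
  A maximal ideal \<open>M\<close> above \<open>P\<close> contains \<open>x\<close> or \<open>\<sim> x\<close>, so not both have finite order modulo \<open>P\<close>.
  Both cannot have infinite order either: one of them, say \<open>\<sim> x\<close>, dominates the other modulo the prime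
  ideal \<open>P\<close>, and a proper ideal containing \<open>P\<close> and \<open>\<sim> x\<close> would then contain \<open>x\<close> as well.
\<close>

lemma perfect_prime_ideal_if_supermaximal:
  assumes sup: "\<And>M. maximal_mv_ideal A M \<Longrightarrow> supermaximal_mv_ideal A M"
    and P: "prime_mv_ideal A P"
  shows "perfect_mv_ideal A P"
proof -
  have idP: "mv_ideal A P" and "\<one> \<notin> P" using P ideal_proper_iff by (auto simp: prime_mv_ideal_def)
  have not_both_inf: "\<exists>n. \<sim> (mv_mult A n (\<sim> x)) \<in> P" if x: "x \<in> carrier A" "x \<ominus> \<sim> x \<in> P" for x
  proof (rule ccontr)
    assume "\<nexists>n. \<sim> (mv_mult A n (\<sim> x)) \<in> P"
    then obtain J where J: "mv_ideal A J" "P \<subseteq> J" "\<sim> x \<in> J" "\<one> \<notin> J"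
      using adjoin_ideal[OF idP, of "\<sim> x"] x by blast
    then have "x \<in> J"
      using ideal_down[OF J(1), of "\<sim> x \<oplus> (x \<ominus> \<sim> x)" x] ideal_oplus[OF J(1), of "\<sim> x" "x \<ominus> \<sim> x"] x le_oplus_diff
      by blast
    then show False using J x ideal_proper_neg by blast
  qed
  have "(\<exists>n. \<sim> (mv_mult A n x) \<in> P) \<noteq> (\<exists>n. \<sim> (mv_mult A n (\<sim> x)) \<in> P)" if x: "x \<in> carrier A" for x
  proof -
    obtain M where M: "maximal_mv_ideal A M" "P \<subseteq> M" using exists_maximal_ideal[OF idP \<open>\<one> \<notin> P\<close>] .
    have idM: "mv_ideal A M" and "\<one> \<notin> M" using M ideal_proper_iff by (auto simp: maximal_mv_ideal_def)
    have inf: "\<nexists>n. \<sim> (mv_mult A n y) \<in> P" if "y \<in> M" for y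
      using ideal_mult[OF idM that] ideal_proper_neg[OF idM \<open>\<one> \<notin> M\<close>] ideal_subset[OF idM] M(2) by blast
    have "x \<in> M \<or> \<sim> x \<in> M" using sup[OF M(1)] supermaximal_iff[OF M(1)] x by blast
    moreover have "(\<exists>n. \<sim> (mv_mult A n x) \<in> P) \<or> (\<exists>n. \<sim> (mv_mult A n (\<sim> x)) \<in> P)"
      using prime_diff[OF P, of x "\<sim> x"] not_both_inf[of x] not_both_inf[of "\<sim> x"] x by auto
    ultimately show ?thesis using inf by blast
  qed
  then show ?thesis using idP by (simp add: perfect_ideal_iff)
qed

lemma maximal_ideal_infinite_order:
  assumes M: "maximal_mv_ideal A M" and x: "x \<in> carrier A" and inf: "\<And>n. \<sim> (mv_mult A n x) \<notin> M"
  shows "x \<in> M"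
proof -
  have "mv_ideal A M" using M by (simp add: maximal_mv_ideal_def)
  then obtain J where "mv_ideal A J" "M \<subseteq> J" "x \<in> J" "\<one> \<notin> J" using adjoin_ideal[of M x] x inf by blast
  then show ?thesis using M ideal_proper_iff unfolding maximal_mv_ideal_def by blast
qed

lemma supermaximal_if_perfect:
  assumes M: "maximal_mv_ideal A M" and "perfect_mv_ideal A M"
  shows "supermaximal_mv_ideal A M"
  using assms maximal_ideal_infinite_order[OF M] neg_closed
  unfolding supermaximal_iff[OF M] perfect_ideal_iff by blast

section \<open>Prime ideals of a quotient\<close>

lemma prime_preimage:
  assumes B: "mv_algebra B" and h: "h \<in> mv_hom A B" and P: "prime_mv_ideal B P"
  shows "prime_mv_ideal A {x \<in> carrier A. h x \<in> P}" (is "prime_mv_ideal A ?P")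
proof -
  interpret B: mv_algebra B by fact
  have idP: "mv_ideal B P" and "mv_one B \<notin> P" using P B.ideal_proper_iff by (auto simp: prime_mv_ideal_def)
  have "mv_ideal A ?P"
    unfolding mv_ideal_def
  proof (intro conjI ballI impI)
    show "?P \<noteq> {}" using B.ideal_zero[OF idP] mv_hom_zero[OF h] by (auto intro!: exI[of _ \<zero>])
  next
    fix x y assume "y \<in> ?P" "x \<in> carrier A" "x \<sqsubseteq> y"
    then show "x \<in> ?P" using B.ideal_down[OF idP, of "h y" "h x"] hom_le[OF h] mv_hom_closed[OF h] by simp
  next
    fix x y assume "x \<in> ?P" "y \<in> ?P"
    then show "x \<oplus> y \<in> ?P" using B.ideal_oplus[OF idP] mv_hom_oplus[OF h] by simp
  qed auto
  moreover have "\<one> \<notin> ?P" using \<open>mv_one B \<notin> P\<close> by (simp add: hom_one[OF h])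
  then have "?P \<noteq> carrier A" using one_closed by blast
  ultimately show ?thesis
    using P by (auto simp: prime_mv_ideal_def hom_meet[OF h] mv_hom_closed[OF h])
qed

text \<open>
  As \<open>h\<close> is onto, the properties of \<open>P\<close> can be checked on representatives. For downward closure the representative of the smaller element has to be replaced by
  its meet with that of the larger one, because the order need not lift.
\<close>

lemma prime_image:
  assumes B: "mv_algebra B" and h: "h \<in> mv_hom A B" and surj: "h ` carrier A = carrier B"
    and P: "prime_mv_ideal A {x \<in> carrier A. h x \<in> P}" and sub: "P \<subseteq> carrier B"
  shows "prime_mv_ideal B P"
proof -
  let ?P = "{x \<in> carrier A. h x \<in> P}"
  interpret B: mv_algebra B by fact
  have idP: "mv_ideal A ?P" and "\<one> \<notin> ?P" using P ideal_proper_iff by (auto simp: prime_mv_ideal_def)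
  have ex: "\<exists>x \<in> carrier A. y = h x" if "y \<in> carrier B" for y using surj that by blast
  have "mv_ideal B P"
    unfolding mv_ideal_def
  proof (intro conjI ballI impI sub)
    show "P \<noteq> {}" using ideal_zero[OF idP] by blast
  next
    fix x y assume *: "y \<in> P" "x \<in> carrier B" "mv_le B x y"
    obtain x' where x': "x' \<in> carrier A" "x = h x'" using ex[of x] sub * by blast
    obtain y' where y': "y' \<in> carrier A" "y = h y'" using ex[of y] sub * by blast
    have "mv_meet A x' y' \<in> ?P"
      using * x' y' ideal_down[OF idP, of y' "mv_meet A x' y'"] by (simp add: meet_lower2)
    moreover have "mv_meet B x y = x"
      using * sub by (intro B.le_antisym) (auto simp: B.meet_lower1 B.le_meet_iff)
    ultimately show "x \<in> P" using x' y' by (simp add: hom_meet[OF h])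
  next
    fix x y assume *: "x \<in> P" "y \<in> P"
    obtain x' where x': "x' \<in> carrier A" "x = h x'" using ex[of x] sub * by blast
    obtain y' where y': "y' \<in> carrier A" "y = h y'" using ex[of y] sub * by blast
    have "x' \<oplus> y' \<in> ?P" using * x' y' ideal_oplus[OF idP] by simp
    then show "oplus B x y \<in> P" using x' y' by (simp add: mv_hom_oplus[OF h])
  qed
  moreover have "P \<noteq> carrier B"
    using hom_one[OF h] \<open>\<one> \<notin> ?P\<close> by auto
  moreover have "x \<in> P \<or> y \<in> P" if xy: "x \<in> carrier B" "y \<in> carrier B" "mv_meet B x y \<in> P" for x y
  proof -
    obtain x' where x': "x' \<in> carrier A" "x = h x'" using ex[of x] xy by auto
    obtain y' where y': "y' \<in> carrier A" "y = h y'" using ex[of y] xy by auto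
    have "mv_meet A x' y' \<in> ?P" using that x' y' by (simp add: hom_meet[OF h])
    then show ?thesis using P x' y' unfolding prime_mv_ideal_def by blast
  qed
  ultimately show ?thesis by (simp add: prime_mv_ideal_def)
qed

lemma perfect_preimage_iff:
  assumes B: "mv_algebra B" and h: "h \<in> mv_hom A B" and surj: "h ` carrier A = carrier B"
    and P: "mv_ideal A {x \<in> carrier A. h x \<in> P}" "mv_ideal B P"
  shows "perfect_mv_ideal A {x \<in> carrier A. h x \<in> P} \<longleftrightarrow> perfect_mv_ideal B P"
proof -
  interpret B: mv_algebra B by fact
  show ?thesis
    using P by (simp add: perfect_ideal_iff B.perfect_ideal_iff hom_mult[OF h] mv_hom_neg[OF h]
        flip: surj)
qed

theorem perfect_primes_quotient_iff:
  assumes I: "mv_ideal A I"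
  shows "(\<forall>P \<in> Spec (mv_quot A I). perfect_mv_ideal (mv_quot A I) P) \<longleftrightarrow>
    (\<forall>P \<in> {P \<in> Spec A. I \<subseteq> P}. perfect_mv_ideal A P)"
proof (intro iffI ballI)
  let ?Q = "mv_quot A I"
  note Q = mv_algebra_quot[OF I] and h = cls_hom[OF I] and surj = quot_carrier[of I, symmetric]
  interpret Q: mv_algebra ?Q by (rule Q)
  {
    fix P assume *: "\<forall>P \<in> Spec ?Q. perfect_mv_ideal ?Q P" and "P \<in> {P \<in> Spec A. I \<subseteq> P}"
    then have P: "prime_mv_ideal A P" "mv_ideal A P" "I \<subseteq> P" by (auto simp: Spec_def prime_mv_ideal_def)
    \<comment> \<open>A prime ideal containing the kernel is saturated.\<close>
    have "x \<in> P" if x: "x \<in> carrier A" and y: "y \<in> P" "cls I x = cls I y" for x y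
    proof -
      have "y \<in> carrier A" using ideal_subset[OF P(2)] y by blast
      then have "x \<ominus> y \<in> P" using x y P(3) by (auto simp: cls_eq_iff[OF I])
      then show ?thesis
        using ideal_down[OF P(2) ideal_oplus[OF P(2) y(1)] x] le_oplus_diff[OF x \<open>y \<in> carrier A\<close>] by blast
    qed
    then have eq: "{x \<in> carrier A. cls I x \<in> cls I ` P} = P"
      using ideal_subset[OF P(2)] by (auto simp del: Image_singleton_iff)
    have "cls I ` P \<subseteq> carrier ?Q" using ideal_subset[OF P(2)] by (auto simp: quot_carrier)
    then have prime: "prime_mv_ideal ?Q (cls I ` P)"
      using prime_image[OF Q h surj, of "cls I ` P"] P(1) eq by simp
    then have "perfect_mv_ideal ?Q (cls I ` P)" using * by (simp add: Spec_def)
    then show "perfect_mv_ideal A P"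
      using perfect_preimage_iff[OF Q h surj, of "cls I ` P"] P(2) eq prime by (simp add: prime_mv_ideal_def)
  next
    fix P assume *: "\<forall>P \<in> {P \<in> Spec A. I \<subseteq> P}. perfect_mv_ideal A P" and "P \<in> Spec ?Q"
    then have P: "prime_mv_ideal ?Q P" "mv_ideal ?Q P" by (auto simp: Spec_def prime_mv_ideal_def)
    let ?P = "{x \<in> carrier A. cls I x \<in> P}"
    have prime: "prime_mv_ideal A ?P" using prime_preimage[OF Q h P(1)] .
    have "cls I x = cls I \<zero>" if "x \<in> I" for x
      using that ideal_subset[OF I that] ideal_zero[OF I] by (simp add: cls_eq_iff[OF I])
    then have "I \<subseteq> ?P"
      using Q.ideal_zero[OF P(2)] ideal_subset[OF I] by (auto simp: quot_zero simp del: Image_singleton_iff)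
    then have "perfect_mv_ideal A ?P" using * prime by (simp add: Spec_def)
    then show "perfect_mv_ideal ?Q P"
      using perfect_preimage_iff[OF Q h surj] P(2) prime by (simp add: prime_mv_ideal_def)
  }
qed

end

section \<open>An identity of the Chang algebra\<close>

lemma Chang_cases:
  assumes "x \<in> carrier Chang"
  obtains b where "0 \<le> b" "x = (0, b)" | b where "0 \<le> b" "x = (1, - b)"
proof (cases x)
  case (Pair a b)
  then have "a = 0 \<and> 0 \<le> b \<or> a = 1 \<and> b \<le> 0"
    using assms by (auto simp: Chang_def less_eq_prod_def)
  then show ?thesis using that(1)[of b] that(2)[of "- b"] Pair by auto
qed

lemma Chang_simps:
  "(0, b) \<in> carrier Chang \<longleftrightarrow> 0 \<le> b"
  "zero Chang = (0, 0)"
  "neg Chang (a, b) = (1 - a, - b)"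
  "oplus Chang (a, b) (c, d) = (if a + c < 1 \<or> a + c = 1 \<and> b + d < 0 then (a + c, b + d) else (1, 0))"
  by (auto simp: Chang_def min_def less_eq_prod_def)

abbreviation square_term :: "'k mv_term \<Rightarrow> 'k mv_term"
  where "square_term t \<equiv> Neg (Plus (Neg t) (Neg t))"

text \<open>
  Doubling and squaring commute: on an infinitesimal \<open>(0, b)\<close> both sides are \<open>(0, 0)\<close>, and on
  \<open>(1, - b)\<close> both are \<open>(1, 0)\<close>.
\<close>

lemma Chang_double_square:
  fixes k :: 'k
  shows "satisfies Chang (Plus (square_term (Var k)) (square_term (Var k)), square_term (Plus (Var k) (Var k)))"
  unfolding satisfies_def
proof clarify
  fix v :: "'k \<Rightarrow> int \<times> int" assume "v \<in> UNIV \<rightarrow> carrier Chang"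
  then have "v k \<in> carrier Chang" by auto
  then show "mv_eval Chang v (Plus (square_term (Var k)) (square_term (Var k))) =
      mv_eval Chang v (square_term (Plus (Var k) (Var k)))"
    by (cases rule: Chang_cases) (simp_all add: Chang_simps)
qed

context mv_algebra
begin

lemma square_zero_iff: "x \<in> carrier A \<Longrightarrow> \<sim> (\<sim> x \<oplus> \<sim> x) = \<zero> \<longleftrightarrow> x \<sqsubseteq> \<sim> x"
  using neg_eq_iff[of "\<sim> x \<oplus> \<sim> x" \<one>] by (simp add: le_iff)

text \<open>
  The identity keeps the square of \<open>2\<^sup>n (x \<and> \<sim> x)\<close> at zero for all \<open>n\<close>. An element of square zero is
  below its own negation, so its negation lies in no proper ideal; therefore \<open>x \<and> \<sim> x\<close>
  has infinite order modulo every maximal ideal and lies in it.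
\<close>

theorem in_variety_Chang_imp_supermaximal:
  assumes var: "in_variety Chang A" and M: "maximal_mv_ideal A M"
  shows "supermaximal_mv_ideal A M"
  unfolding supermaximal_iff[OF M]
proof
  fix x assume x: "x \<in> carrier A"
  have idM: "mv_ideal A M" and "\<one> \<notin> M" using M ideal_proper_iff by (auto simp: maximal_mv_ideal_def)
  have eq: "\<sim> (\<sim> y \<oplus> \<sim> y) \<oplus> \<sim> (\<sim> y \<oplus> \<sim> y) = \<sim> (\<sim> (y \<oplus> y) \<oplus> \<sim> (y \<oplus> y))" if "y \<in> carrier A" for y
  proof -
    have "satisfies A (Plus (square_term (Var 0)) (square_term (Var 0)),
        square_term (Plus (Var (0 :: nat)) (Var 0)))"
      using var Chang_double_square[of "0::nat"] unfolding in_variety_def by blast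
    then have all: "\<forall>v \<in> UNIV \<rightarrow> carrier A. \<sim> (\<sim> v 0 \<oplus> \<sim> v 0) \<oplus> \<sim> (\<sim> v 0 \<oplus> \<sim> v 0) =
        \<sim> (\<sim> (v (0::nat) \<oplus> v 0) \<oplus> \<sim> (v 0 \<oplus> v 0))" by (simp add: satisfies_def)
    have "(\<lambda>_. y) \<in> UNIV \<rightarrow> carrier A" using that by simp
    from bspec[OF all this] show ?thesis .
  qed
  define y where "y = mv_meet A x (\<sim> x)"
  have y: "y \<in> carrier A" using x by (simp add: y_def)
  have yy: "y \<sqsubseteq> \<sim> y"
  proof -
    have "y \<sqsubseteq> \<sim> x" "\<sim> x \<sqsubseteq> \<sim> y" using x by (simp_all add: y_def neg_le_iff meet_lower1 meet_lower2)
    then show ?thesis using x y le_trans[of y "\<sim> x" "\<sim> y"] by simp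
  qed
  \<comment> \<open>For \<open>z \<sqsubseteq> \<sim> z\<close>, that is \<open>z\<^sup>2 = 0\<close>, the identity gives \<open>(2 z)\<^sup>2 = 2 z\<^sup>2 = 0\<close>.\<close>
  have pow: "mv_mult A (2 ^ n) y \<sqsubseteq> \<sim> (mv_mult A (2 ^ n) y)" for n
  proof (induction n)
    case 0
    then show ?case using y yy by simp
  next
    case (Suc n)
    let ?z = "mv_mult A (2 ^ n) y"
    have "\<sim> (\<sim> ?z \<oplus> \<sim> ?z) = \<zero>" using Suc y by (simp add: square_zero_iff)
    then have "\<sim> (\<sim> (?z \<oplus> ?z) \<oplus> \<sim> (?z \<oplus> ?z)) = \<zero>" using eq[of ?z] y by simp
    moreover have "mv_mult A (2 ^ Suc n) y = ?z \<oplus> ?z" using y by (simp add: mult_2 mult_add)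
    ultimately show ?case using y by (simp add: square_zero_iff)
  qed
  have "y \<in> M"
  proof (rule maximal_ideal_infinite_order[OF M y])
    fix n
    let ?z = "mv_mult A (2 ^ n) y"
    have "n \<le> 2 ^ n" by (rule less_imp_le) simp
    then have "?z = mv_mult A n y \<oplus> mv_mult A (2 ^ n - n) y" using y by (simp flip: mult_add)
    then have "\<sim> ?z \<sqsubseteq> \<sim> (mv_mult A n y)" using y by (simp add: neg_le_iff le_oplus')
    then have "\<sim> ?z \<in> M \<and> ?z \<in> M" if "\<sim> (mv_mult A n y) \<in> M"
      using ideal_down[OF idM that, of "\<sim> ?z"] ideal_down[OF idM _ _ pow[of n]] y by simp
    then show "\<sim> (mv_mult A n y) \<notin> M" using ideal_proper_neg[OF idM \<open>\<one> \<notin> M\<close>] y by blast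
  qed
  then show "x \<in> M \<or> \<sim> x \<in> M"
    using maximal_ideal_prime[OF M] x by (auto simp: y_def prime_mv_ideal_def)
qed

end

section \<open>Sign patterns of integer linear forms\<close>

text \<open>
  The nonnegative part of a translation-invariant total preorder on the group. Nonzero \<open>f\<close> with both
  \<open>f\<close> and \<open>- f\<close> in the cone are allowed; they stand for linear relations between the generators.
\<close>

definition total_cone :: "'a::ab_group_add set \<Rightarrow> bool" where
  "total_cone C \<longleftrightarrow> (\<forall>f \<in> C. \<forall>g \<in> C. f + g \<in> C) \<and> (\<forall>f. f \<in> C \<or> - f \<in> C)"

lemma total_cone_add: "total_cone C \<Longrightarrow> f \<in> C \<Longrightarrow> g \<in> C \<Longrightarrow> f + g \<in> C"
  and total_cone_total: "total_cone C \<Longrightarrow> f \<notin> C \<Longrightarrow> - f \<in> C"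
  by (auto simp: total_cone_def)

lemma total_cone_zero: "total_cone C \<Longrightarrow> 0 \<in> C"
  by (metis total_cone_def neg_equal_zero minus_zero)

lemma total_cone_scale:
  fixes C :: "('i \<Rightarrow> int) set"
  assumes C: "total_cone C" and "0 < m"
  shows "(\<lambda>i. m * f i) \<in> C \<longleftrightarrow> f \<in> C"
proof -
  have up: "(\<lambda>i. int k * g i) \<in> C" if "g \<in> C" for k g
  proof (induction k)
    case 0
    then show ?case using total_cone_zero[OF C] by (simp add: zero_fun_def)
  next
    case (Suc k)
    then have "g + (\<lambda>i. int k * g i) \<in> C" using total_cone_add[OF C \<open>g \<in> C\<close>] by blast
    then show ?case by (simp add: plus_fun_def algebra_simps)
  qed
  have "f \<in> C" if "(\<lambda>i. m * f i) \<in> C"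
  proof (rule ccontr)
    assume "f \<notin> C"
    then have "- f \<in> C" using total_cone_total[OF C] by blast
    from total_cone_add[OF C that up[OF this, of "nat (m - 1)"]]
    have "f \<in> C" using \<open>0 < m\<close> by (simp add: plus_fun_def fun_Compl_def algebra_simps)
    with \<open>f \<notin> C\<close> show False ..
  qed
  moreover have "(\<lambda>i. m * f i) \<in> C" if "f \<in> C"
    using up[OF that, of "nat m"] \<open>0 < m\<close> by simp
  ultimately show ?thesis by blast
qed

text \<open>
  One step of Fourier-Motzkin elimination. The unknown \<open>z\<close> is to satisfy \<open>z \<ge> - b f\<close> exactly for
  \<open>f \<in> U\<close> and \<open>z \<le> - b f\<close> exactly for \<open>f \<in> L\<close>; the last three hypotheses say that these demands are
  consistent as far as the order of the bounds is concerned. Over the integers there also has to be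
  room strictly between two distinct bounds, and evenness of the bounds provides it.
\<close>

lemma integer_cut:
  fixes b :: "'a \<Rightarrow> int"
  assumes "finite F" and even: "\<And>f. f \<in> F \<Longrightarrow> even (b f)"
    and total: "\<And>f. f \<in> F \<Longrightarrow> f \<in> U \<or> f \<in> L"
    and UL: "\<And>f g. f \<in> F \<Longrightarrow> g \<in> F \<Longrightarrow> f \<in> U \<Longrightarrow> g \<in> L \<Longrightarrow> b g \<le> b f"
    and UU: "\<And>f g. f \<in> F \<Longrightarrow> g \<in> F \<Longrightarrow> f \<in> U \<Longrightarrow> g \<notin> U \<Longrightarrow> b g < b f"
    and LL: "\<And>f g. f \<in> F \<Longrightarrow> g \<in> F \<Longrightarrow> f \<notin> L \<Longrightarrow> g \<in> L \<Longrightarrow> b g < b f"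
  shows "\<exists>z. \<forall>f \<in> F. (f \<in> U \<longleftrightarrow> 0 \<le> z + b f) \<and> (f \<in> L \<longleftrightarrow> z + b f \<le> 0)"
proof (cases "\<exists>e \<in> F. e \<in> U \<and> e \<in> L")
  case True
  then obtain e where e: "e \<in> F" "e \<in> U" "e \<in> L" by blast
  have "(f \<in> U \<longleftrightarrow> 0 \<le> - b e + b f) \<and> (f \<in> L \<longleftrightarrow> - b e + b f \<le> 0)" if "f \<in> F" for f
    using UL[OF that e(1)] UL[OF e(1) that] UU[OF e(1) that] LL[OF that e(1)] e that by force
  then show ?thesis by blast
next
  case False
  show ?thesis
  proof (cases "F \<inter> U = {}")
    case True
    define z where "z = - 1 - (\<Sum>f\<in>F. \<bar>b f\<bar>)"
    have "z + b f < 0" if "f \<in> F" for f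
      using member_le_sum[of f F "\<lambda>f. \<bar>b f\<bar>"] that \<open>finite F\<close> by (simp add: z_def)
    then show ?thesis using True total by (intro exI[of _ z]) force
  next
    case False
    define m where "m = Min (b ` (F \<inter> U))"
    have "m \<in> b ` (F \<inter> U)" using False \<open>finite F\<close> by (simp add: m_def)
    then obtain e where e: "e \<in> F" "e \<in> U" "m = b e" by blast
    have le: "m \<le> b f" if "f \<in> F" "f \<in> U" for f using that \<open>finite F\<close> by (simp add: m_def)
    have "b f + 2 \<le> m" if "f \<in> F" "f \<notin> U" for f
      using UU[OF e(1) that(1) e(2) that(2)] even[OF that(1)] even[OF e(1)] unfolding e(3) by presburger
    then have "(f \<in> U \<longleftrightarrow> 0 \<le> (1 - m) + b f) \<and> (f \<in> L \<longleftrightarrow> (1 - m) + b f \<le> 0)" if "f \<in> F" for f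
      using le[OF that] total[OF that] \<open>\<not> (\<exists>e\<in>F. e \<in> U \<and> e \<in> L)\<close> that by force
    then show ?thesis by blast
  qed
qed

text \<open>
  Every finite part of a totally ordered group with \<open>n\<close> generators looks like a part of \<open>\<int>\<close>. The proof
  eliminates the last coordinate. All forms in \<open>X\<close> that involve it are scaled to have the same last
  coefficient \<open>N\<close>; their signs then express where \<open>N\<close> times the last generator lies among finitely many
  values of forms in the earlier generators. The order of these values is encoded in the signs of the
  differences, to which the induction hypothesis applies, and \<open>integer_cut\<close> places the last generator.
\<close>

theorem total_cone_sign_realization:
  fixes C :: "(nat \<Rightarrow> int) set"
  assumes C: "total_cone C" and "finite X" and "\<And>f i. f \<in> X \<Longrightarrow> n \<le> i \<Longrightarrow> f i = 0"
  shows "\<exists>h :: nat \<Rightarrow> int. \<forall>f \<in> X. f \<in> C \<longleftrightarrow> 0 \<le> (\<Sum>i<n. f i * h i)"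
  using assms(2,3)
proof (induction n arbitrary: X)
  case 0
  then have "f = 0" if "f \<in> X" for f using that by (auto simp: fun_eq_iff)
  then show ?case using total_cone_zero[OF C] by auto
next
  case (Suc n)
  define F where "F = {f \<in> X. f n \<noteq> 0}"
  define N where "N = (\<Prod>f\<in>F. \<bar>f n\<bar>)"
  have "finite F" using Suc.prems by (simp add: F_def)
  have "0 < N" by (auto simp: N_def F_def intro!: prod_pos)
  have dvd: "f n dvd N" if "f \<in> F" for f
    using dvd_prodI[OF \<open>finite F\<close> that, of "\<lambda>f. \<bar>f n\<bar>"] by (simp add: N_def)
  \<comment> \<open>The scaling factor may be negative; then membership of \<open>f\<close> in the cone becomes membership of
    the negated scaled form.\<close>
  define s where "s f = N div f n" for f :: "nat \<Rightarrow> int"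
  have s: "s f * f n = N" "s f \<noteq> 0" "0 < s f \<longleftrightarrow> 0 < f n" if "f \<in> F" for f
  proof -
    show 1: "s f * f n = N" using dvd[OF that] by (simp add: s_def)
    show "s f \<noteq> 0" using 1 \<open>0 < N\<close> by auto
    show "0 < s f \<longleftrightarrow> 0 < f n" using 1 \<open>0 < N\<close> by (metis zero_less_mult_iff mult.commute less_asym)
  qed
  define c where "c f = (\<lambda>i. s f * f i)" for f :: "nat \<Rightarrow> int"
  have cn: "c f n = N" if "f \<in> F" for f using s(1)[OF that] by (simp add: c_def)
  define Y where "Y = {f \<in> X. f n = 0} \<union> (\<lambda>(f, g). c f - c g) ` (F \<times> F)"
  have "finite Y" using Suc.prems \<open>finite F\<close> by (simp add: Y_def)
  moreover have "f i = 0" if "f \<in> Y" "n \<le> i" for f i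
  proof (cases "i = n")
    case True
    then show ?thesis using that cn by (auto simp: Y_def)
  next
    case False
    then have z: "g i = 0" if "g \<in> X" for g using Suc.prems(2)[OF that] \<open>n \<le> i\<close> by simp
    from that(1) consider "f \<in> X" | g k where "g \<in> X" "k \<in> X" "f = c g - c k"
      by (auto simp: Y_def F_def)
    then show ?thesis using z[of f] z by cases (auto simp: c_def z)
  qed
  ultimately obtain h where h: "\<forall>f \<in> Y. f \<in> C \<longleftrightarrow> 0 \<le> (\<Sum>i<n. f i * h i)"
    using Suc.IH[of Y] by blast
  define b where "b f = 2 * (\<Sum>i<n. c f i * h i)" for f
  define U where "U = {f. c f \<in> C}"
  define L where "L = {f. - c f \<in> C}"
  have b: "c f - c g \<in> C \<longleftrightarrow> b g \<le> b f" if "f \<in> F" "g \<in> F" for f g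
  proof -
    have "c f - c g \<in> Y" using that by (auto simp: Y_def)
    then have "c f - c g \<in> C \<longleftrightarrow> 0 \<le> (\<Sum>i<n. (c f - c g) i * h i)" using h by blast
    then show ?thesis by (simp add: b_def left_diff_distrib sum_subtractf)
  qed
  have "\<exists>z. \<forall>f \<in> F. (f \<in> U \<longleftrightarrow> 0 \<le> z + b f) \<and> (f \<in> L \<longleftrightarrow> z + b f \<le> 0)"
  proof (rule integer_cut[OF \<open>finite F\<close>])
    show "even (b f)" for f by (simp add: b_def)
    show "f \<in> U \<or> f \<in> L" for f using total_cone_total[OF C] by (auto simp: U_def L_def)
    fix f g assume fg: "f \<in> F" "g \<in> F"
    show "b g \<le> b f" if "f \<in> U" "g \<in> L"
      using total_cone_add[OF C, of "c f" "- c g"] that b[OF fg] by (simp add: U_def L_def)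
    show "b g < b f" if "f \<in> U" "g \<notin> U"
      using total_cone_add[OF C, of "c g - c f" "c f"] that b[OF fg(2,1)] by (force simp: U_def)
    show "b g < b f" if "f \<notin> L" "g \<in> L"
      using total_cone_add[OF C, of "c g - c f" "- c g"] that b[OF fg(2,1)] by (force simp: L_def)
  qed
  then obtain z where z: "\<And>f. f \<in> F \<Longrightarrow> f \<in> U \<longleftrightarrow> 0 \<le> z + b f" "\<And>f. f \<in> F \<Longrightarrow> f \<in> L \<longleftrightarrow> z + b f \<le> 0"
    by blast
  \<comment> \<open>Scaling the earlier values by \<open>2 N\<close> keeps all signs, and makes the bounds for \<open>N z\<close> even
    multiples of \<open>N\<close>.\<close>
  define k where "k i = (if i = n then z else 2 * N * h i)" for i
  have sumk: "(\<Sum>i<Suc n. f i * k i) = f n * z + 2 * N * (\<Sum>i<n. f i * h i)" for f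
    by (simp add: k_def sum_distrib_left mult_ac)
  have "f \<in> C \<longleftrightarrow> 0 \<le> (\<Sum>i<Suc n. f i * k i)" if "f \<in> X" for f
  proof (cases "f \<in> F")
    case False
    then have "f \<in> Y" "f n = 0" using that by (auto simp: Y_def F_def)
    then show ?thesis unfolding sumk using h \<open>0 < N\<close> by (simp add: zero_le_mult_iff)
  next
    case True
    have "s f * (\<Sum>i<Suc n. f i * k i) = N * (z + b f)"
      unfolding sumk using s(1)[OF True] by (simp add: b_def c_def sum_distrib_left algebra_simps)
    then have sg: "0 \<le> s f * (\<Sum>i<Suc n. f i * k i) \<longleftrightarrow> 0 \<le> z + b f"
      "s f * (\<Sum>i<Suc n. f i * k i) \<le> 0 \<longleftrightarrow> z + b f \<le> 0"
      using \<open>0 < N\<close> by (simp_all add: zero_le_mult_iff mult_le_0_iff)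
    show ?thesis
    proof (cases "0 < s f")
      case pos: True
      then have "f \<in> C \<longleftrightarrow> f \<in> U" using total_cone_scale[OF C pos] by (simp add: U_def c_def)
      then show ?thesis using z(1)[OF True] sg(1) pos by (simp add: zero_le_mult_iff)
    next
      case neg: False
      then have neg: "0 < - s f" using s(2)[OF True] by simp
      then have "f \<in> C \<longleftrightarrow> f \<in> L"
        using total_cone_scale[OF C neg, of f] by (simp add: L_def c_def fun_Compl_def)
      then show ?thesis using z(2)[OF True] sg(2) neg by (simp add: mult_le_0_iff)
    qed
  qed
  then show ?case by blast
qed

section \<open>Infinitesimals of a perfect chain\<close>

lemma mv_order_infinite_iff: "mv_order A x = \<infinity> \<longleftrightarrow> (\<forall>n. mv_mult A n x \<noteq> mv_one A)"
  by (simp add: mv_order_def)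

locale perfect_chain = mv_algebra +
  assumes chain: "x \<in> carrier A \<Longrightarrow> y \<in> carrier A \<Longrightarrow> x \<sqsubseteq> y \<or> y \<sqsubseteq> x"
    and perfect: "perfect_mv A"
begin

text \<open>
  The elements of infinite order, which form the only maximal ideal; they are the infinitesimals.
\<close>

definition Rad :: "'a set" where
  "Rad = {x \<in> carrier A. \<forall>n. mv_mult A n x \<noteq> \<one>}"

lemma Rad_closed [simp, intro]: "x \<in> Rad \<Longrightarrow> x \<in> carrier A"
  by (simp add: Rad_def)

lemma neg_Rad_iff: "x \<in> carrier A \<Longrightarrow> \<sim> x \<in> Rad \<longleftrightarrow> x \<notin> Rad"
  using perfect unfolding perfect_mv_def Rad_def mv_order_infinite_iff by blast

lemma zero_Rad [simp, intro]: "\<zero> \<in> Rad"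
proof -
  have "mv_mult A 1 \<one> = \<one>" by simp
  then have "\<one> \<notin> Rad" unfolding Rad_def by blast
  then show ?thesis using neg_Rad_iff[of \<one>] by simp
qed

lemma Rad_down: "y \<in> Rad \<Longrightarrow> x \<in> carrier A \<Longrightarrow> x \<sqsubseteq> y \<Longrightarrow> x \<in> Rad"
  unfolding Rad_def by clarsimp (metis mult_closed mult_mono one_le_iff)

lemma mult_double: "x \<in> carrier A \<Longrightarrow> mv_mult A n (x \<oplus> x) = mv_mult A (n + n) x"
  by (induction n) (simp_all add: oplus_assoc)

lemma Rad_oplus [simp, intro]:
  assumes "x \<in> Rad" "y \<in> Rad"
  shows "x \<oplus> y \<in> Rad"
proof -
  have *: "x \<oplus> y \<in> Rad" if "x \<in> Rad" "y \<in> Rad" "x \<sqsubseteq> y" for x y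
  proof (rule Rad_down)
    show "y \<oplus> y \<in> Rad" using that by (simp add: Rad_def mult_double del: Rad_closed)
    show "x \<oplus> y \<sqsubseteq> y \<oplus> y" using that by (simp add: oplus_mono2)
  qed (use that in auto)
  show ?thesis using chain[of x y] *[of x y] *[of y x] assms by (auto simp: oplus_comm)
qed

lemma Rad_mult [simp, intro]: "x \<in> Rad \<Longrightarrow> mv_mult A n x \<in> Rad"
  by (induction n) auto

text \<open>
  So the sum of infinitesimals is never truncated, and the infinitesimals form a cancellative monoid.
\<close>

lemma Rad_le_neg: "x \<in> Rad \<Longrightarrow> y \<in> Rad \<Longrightarrow> x \<sqsubseteq> \<sim> y"
  by (meson chain Rad_down neg_Rad_iff Rad_closed neg_closed)

lemma Rad_add_diff:
  assumes "x \<in> Rad" "z \<in> Rad"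
  shows "(x \<oplus> z) \<ominus> z = x"
proof -
  have "(x \<oplus> z) \<ominus> z = \<sim> z \<ominus> (\<sim> z \<ominus> x)"
    using assms by (simp add: mv_diff_def oplus_comm)
  also have "\<dots> = mv_meet A (\<sim> z) x" using assms by (simp add: meet_eq)
  also have "\<dots> = x"
    using assms by (intro le_antisym) (auto simp: meet_lower2 le_meet_iff Rad_le_neg)
  finally show ?thesis .
qed

lemma Rad_cancel_le:
  assumes "x \<in> Rad" "y \<in> Rad" "z \<in> Rad"
  shows "x \<oplus> z \<sqsubseteq> y \<oplus> z \<longleftrightarrow> x \<sqsubseteq> y"
proof
  assume "x \<oplus> z \<sqsubseteq> y \<oplus> z"
  then show "x \<sqsubseteq> y" using diff_mono[of "x \<oplus> z" "y \<oplus> z" z] assms by (simp add: Rad_add_diff)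
qed (use assms in \<open>simp add: oplus_mono2\<close>)

end

section \<open>Integer vectors as differences\<close>

primrec mv_lincomb :: "'a mv \<Rightarrow> (nat \<Rightarrow> 'a) \<Rightarrow> nat \<Rightarrow> (nat \<Rightarrow> nat) \<Rightarrow> 'a" where
  "mv_lincomb A g 0 p = zero A"
| "mv_lincomb A g (Suc n) p = oplus A (mv_lincomb A g n p) (mv_mult A (p n) (g n))"

definition int_diff :: "(nat \<Rightarrow> nat) \<Rightarrow> (nat \<Rightarrow> nat) \<Rightarrow> nat \<Rightarrow> int" where
  "int_diff p q = (\<lambda>i. int (p i) - int (q i))"

lemma int_diff_surj: "\<exists>p q. f = int_diff p q"
  by (intro exI[of _ "\<lambda>i. nat (f i)"] exI[of _ "\<lambda>i. nat (- f i)"]) (auto simp: int_diff_def)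

lemma int_diff_simps:
  "int_diff p q + int_diff p' q' = int_diff (p + p') (q + q')"
  "- int_diff p q = int_diff q p"
  "int_diff p q - int_diff p' q' = int_diff (p + q') (q + p')"
  by (auto simp: int_diff_def fun_eq_iff)

text \<open>
  Two representations of a vector as a difference have equal cross sums; this makes notions that are
  defined through a representation independent of it, by cancellation.
\<close>

lemma int_diff_eq:
  assumes "int_diff p q = int_diff p' q'" shows "p + q' = p' + q"
proof
  fix i show "(p + q') i = (p' + q) i"
    using fun_cong[OF assms, of i] by (simp add: int_diff_def)
qed

section \<open>Symbolic evaluation of terms\<close>

definition unit_form :: "nat \<Rightarrow> nat \<Rightarrow> int" where
  "unit_form k = (\<lambda>i. if i = k then 1 else 0)"

definition pos_form :: "(nat \<Rightarrow> int) set \<Rightarrow> (nat \<Rightarrow> int) \<Rightarrow> nat \<Rightarrow> int" where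
  "pos_form C f = (if f \<in> C then f else 0)"

text \<open>
  Evaluation in \<open>\<Gamma>(\<int> lex \<int>\<^sup>n, (1, 0))\<close>, where \<open>\<int>\<^sup>n\<close> is ordered by the total cone \<open>C\<close>. A pair
  \<open>(False, f)\<close> stands for the infinitesimal \<open>(0, f)\<close> and \<open>(True, f)\<close> for its negation \<open>(1, - f)\<close>.
  The \<open>k\<close>-th variable is the \<open>k\<close>-th unit vector, negated if \<open>\<beta> k\<close> holds.
\<close>

primrec sym_eval :: "(nat \<Rightarrow> int) set \<Rightarrow> (nat \<Rightarrow> bool) \<Rightarrow> nat mv_term \<Rightarrow> bool \<times> (nat \<Rightarrow> int)" where
  "sym_eval C \<beta> (Var k) = (\<beta> k, unit_form k)"
| "sym_eval C \<beta> Zero = (False, 0)"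
| "sym_eval C \<beta> (Neg t) = (case sym_eval C \<beta> t of (b, f) \<Rightarrow> (\<not> b, f))"
| "sym_eval C \<beta> (Plus s t) = (case (sym_eval C \<beta> s, sym_eval C \<beta> t) of
     ((False, f), (False, g)) \<Rightarrow> (False, f + g)
   | ((True, f), (False, g)) \<Rightarrow> (True, pos_form C (f - g))
   | ((False, f), (True, g)) \<Rightarrow> (True, pos_form C (g - f))
   | ((True, f), (True, g)) \<Rightarrow> (True, 0))"

text \<open>
  The vectors whose membership in \<open>C\<close> determines the course of \<open>sym_eval\<close>. Both differences are
  included at every sum, so that the comparisons of \<open>Plus s t\<close> also decide whether \<open>s\<close> and \<open>t\<close> have
  the same value.
\<close>

primrec comparisons :: "(nat \<Rightarrow> int) set \<Rightarrow> (nat \<Rightarrow> bool) \<Rightarrow> nat mv_term \<Rightarrow> (nat \<Rightarrow> int) set" where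
  "comparisons C \<beta> (Var k) = {}"
| "comparisons C \<beta> Zero = {}"
| "comparisons C \<beta> (Neg t) = comparisons C \<beta> t"
| "comparisons C \<beta> (Plus s t) = comparisons C \<beta> s \<union> comparisons C \<beta> t \<union>
    {snd (sym_eval C \<beta> s) - snd (sym_eval C \<beta> t), snd (sym_eval C \<beta> t) - snd (sym_eval C \<beta> s)}"

lemma finite_comparisons: "finite (comparisons C \<beta> t)"
  by (induction t) auto

lemma sym_eval_support: "vars t \<subseteq> {..<n} \<Longrightarrow> n \<le> i \<Longrightarrow> snd (sym_eval C \<beta> t) i = 0"
  by (induction t) (auto simp: unit_form_def pos_form_def split: prod.splits bool.splits)

lemma comparisons_support: "vars t \<subseteq> {..<n} \<Longrightarrow> n \<le> i \<Longrightarrow> f \<in> comparisons C \<beta> t \<Longrightarrow> f i = 0"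
  by (induction t) (auto simp: unit_form_def sym_eval_support)

text \<open>
  Any relation \<open>R\<close> between elements and vectors that respects zero, sums and truncated differences
  transports the symbolic value of a term to its actual value. It will be used for a perfect chain and
  for the Chang algebra. Truncated differences are required to be respected only for differences in \<open>T\<close>
  because the integer model reproduces the order of the chain on finitely many vectors only.
\<close>

lemma (in mv_algebra) eval_sym_eval:
  fixes R :: "'a \<Rightarrow> (nat \<Rightarrow> int) \<Rightarrow> bool"
  assumes closed: "\<And>m f. R m f \<Longrightarrow> m \<in> carrier A"
    and zero: "R \<zero> 0"
    and plus: "\<And>m f m' f'. R m f \<Longrightarrow> R m' f' \<Longrightarrow> R (m \<oplus> m') (f + f')"
    and diff: "\<And>m f m' f'. R m f \<Longrightarrow> R m' f' \<Longrightarrow> f - f' \<in> T \<Longrightarrow> R (m \<ominus> m') (pos_form C (f - f'))"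
    and small: "\<And>m f m' f'. R m f \<Longrightarrow> R m' f' \<Longrightarrow> m \<sqsubseteq> \<sim> m'"
  shows "(\<And>k. k \<in> vars t \<Longrightarrow> \<exists>m. R m (unit_form k) \<and> v k = (if \<beta> k then \<sim> m else m)) \<Longrightarrow>
    comparisons C \<beta> t \<subseteq> T \<Longrightarrow>
    \<exists>m. R m (snd (sym_eval C \<beta> t)) \<and> mv_eval A v t = (if fst (sym_eval C \<beta> t) then \<sim> m else m)"
proof (induction t)
  case (Neg t)
  then obtain m where "R m (snd (sym_eval C \<beta> t))"
    "mv_eval A v t = (if fst (sym_eval C \<beta> t) then \<sim> m else m)" by auto
  then show ?case using closed by (auto split: prod.splits)
next
  case (Plus s t)
  obtain b f where s: "sym_eval C \<beta> s = (b, f)" by (cases "sym_eval C \<beta> s")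
  obtain c g where t: "sym_eval C \<beta> t = (c, g)" by (cases "sym_eval C \<beta> t")
  have T: "f - g \<in> T" "g - f \<in> T" using Plus.prems(2) s t by auto
  obtain m where m: "R m f" "mv_eval A v s = (if b then \<sim> m else m)"
    using Plus.IH(1) Plus.prems s by auto
  obtain m' where m': "R m' g" "mv_eval A v t = (if c then \<sim> m' else m')"
    using Plus.IH(2) Plus.prems t by auto
  have c [simp]: "m \<in> carrier A" "m' \<in> carrier A" using m m' closed by auto
  show ?case
  proof (cases b)
    case b: True
    show ?thesis
    proof (cases c)
      case True
      have "\<sim> m \<oplus> \<sim> m' = \<sim> \<zero>" using small[OF m(1) m'(1)] by (simp add: le_iff)
      then show ?thesis using s t m m' zero b True by (auto simp: zero_fun_def)
    next
      case False
      have "\<sim> m \<oplus> m' = \<sim> (m \<ominus> m')" by (simp add: mv_diff_def)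
      then show ?thesis using s t m m' diff[OF m(1) m'(1) T(1)] b False by auto
    qed
  next
    case b: False
    show ?thesis
    proof (cases c)
      case True
      have "m \<oplus> \<sim> m' = \<sim> (m' \<ominus> m)" by (simp add: mv_diff_def oplus_comm)
      then show ?thesis using s t m m' diff[OF m'(1) m(1) T(2)] b True by auto
    next
      case False
      then show ?thesis using s t m m' plus[OF m(1) m'(1)] b False by (auto simp: plus_fun_def)
    qed
  qed
qed (use zero in auto)

section \<open>Identities of perfect chains\<close>

locale perfect_chain_gens = perfect_chain +
  fixes g :: "nat \<Rightarrow> 'a" and n :: nat
  assumes g_Rad: "g i \<in> Rad"
begin

abbreviation lincomb :: "(nat \<Rightarrow> nat) \<Rightarrow> 'a" where "lincomb \<equiv> mv_lincomb A g n"

lemma lincomb_Rad [simp, intro]: "lincomb p \<in> Rad"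
  by (induction n) (auto simp: g_Rad)

lemma lincomb_add: "lincomb (p + q) = lincomb p \<oplus> lincomb q"
proof (induction n)
  case (Suc n)
  have "mv_lincomb A g n p \<in> Rad" for p by (induction n) (auto simp: g_Rad)
  then show ?case using Suc g_Rad by (simp add: mult_add oplus_ac)
qed simp

lemma lincomb_zero: "lincomb 0 = \<zero>"
  by (induction n) auto

lemma lincomb_unit:
  assumes "k < n" shows "lincomb (\<lambda>i. if i = k then 1 else 0) = g k"
proof -
  have "mv_lincomb A g m (\<lambda>i. if i = k then 1 else 0) = (if k < m then g k else \<zero>)" for m
    by (induction m) (use g_Rad in \<open>auto simp: less_Suc_eq\<close>)
  then show ?thesis using assms by simp
qed

text \<open>
  The infinitesimal \<open>m\<close> is the value of the vector \<open>f\<close> at the generators. Subtraction in the algebra is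
  truncated, so the negative part of \<open>f\<close> is moved to the side of \<open>m\<close>.
\<close>

definition represents :: "'a \<Rightarrow> (nat \<Rightarrow> int) \<Rightarrow> bool" where
  "represents m f \<longleftrightarrow> m \<in> Rad \<and> (\<exists>p q. f = int_diff p q \<and> m \<oplus> lincomb q = lincomb p)"

text \<open>
  The vectors with nonnegative value at the generators.
\<close>

definition cone :: "(nat \<Rightarrow> int) set" where
  "cone = {int_diff p q | p q. lincomb q \<sqsubseteq> lincomb p}"

lemma int_diff_cone_iff: "int_diff p q \<in> cone \<longleftrightarrow> lincomb q \<sqsubseteq> lincomb p"
proof
  assume "int_diff p q \<in> cone"
  then obtain p' q' where eq: "int_diff p q = int_diff p' q'" and le: "lincomb q' \<sqsubseteq> lincomb p'"
    by (auto simp: cone_def)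
  have "lincomb q \<oplus> lincomb q' \<sqsubseteq> lincomb q \<oplus> lincomb p'" using le by (simp add: oplus_mono)
  also have "\<dots> = lincomb (p' + q)" by (simp add: lincomb_add oplus_comm)
  also have "\<dots> = lincomb p \<oplus> lincomb q'" by (simp add: lincomb_add flip: int_diff_eq[OF eq])
  finally show "lincomb q \<sqsubseteq> lincomb p" by (simp add: Rad_cancel_le)
qed (auto simp: cone_def)

lemma total_cone_cone: "total_cone cone"
  unfolding total_cone_def
proof (intro conjI ballI allI)
  fix f f' assume "f \<in> cone" "f' \<in> cone"
  moreover obtain p q where "f = int_diff p q" using int_diff_surj by blast
  moreover obtain p' q' where "f' = int_diff p' q'" using int_diff_surj by blast
  ultimately show "f + f' \<in> cone" by (simp add: int_diff_simps int_diff_cone_iff lincomb_add oplus_mono2)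
next
  fix f
  obtain p q where "f = int_diff p q" using int_diff_surj by blast
  then show "f \<in> cone \<or> - f \<in> cone"
    using chain[of "lincomb p" "lincomb q"] by (auto simp: int_diff_simps int_diff_cone_iff)
qed

lemma represents_zero: "represents \<zero> 0"
  by (auto simp: represents_def int_diff_def fun_eq_iff intro!: exI[of _ 0])

lemma represents_unit:
  assumes "k < n" shows "represents (g k) (unit_form k)"
proof -
  have "unit_form k = int_diff (\<lambda>i. if i = k then 1 else 0) 0"
    by (auto simp: unit_form_def int_diff_def fun_eq_iff)
  moreover have "g k \<oplus> lincomb 0 = lincomb (\<lambda>i. if i = k then 1 else 0)"
    using g_Rad by (simp add: lincomb_unit[OF assms] lincomb_zero)
  ultimately show ?thesis unfolding represents_def using g_Rad by blast
qed

lemma represents_add: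
  assumes "represents m f" "represents m' f'"
  shows "represents (m \<oplus> m') (f + f')"
proof -
  obtain p q p' q' where *: "f = int_diff p q" "m \<oplus> lincomb q = lincomb p"
    "f' = int_diff p' q'" "m' \<oplus> lincomb q' = lincomb p'" "m \<in> Rad" "m' \<in> Rad"
    using assms by (auto simp: represents_def)
  have "(m \<oplus> m') \<oplus> (lincomb q \<oplus> lincomb q') = (m \<oplus> lincomb q) \<oplus> (m' \<oplus> lincomb q')"
    using *(5,6) by (simp add: oplus_ac)
  then have "(m \<oplus> m') \<oplus> lincomb (q + q') = lincomb (p + p')"
    using * by (simp add: lincomb_add)
  moreover have "f + f' = int_diff (p + p') (q + q')" using * by (simp add: int_diff_simps)
  ultimately show ?thesis using *(5,6) unfolding represents_def by blast
qed

lemma represents_le_iff: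
  assumes "represents m f" "represents m' f'"
  shows "m' \<sqsubseteq> m \<longleftrightarrow> f - f' \<in> cone"
proof -
  obtain p q p' q' where *: "f = int_diff p q" "m \<oplus> lincomb q = lincomb p"
    "f' = int_diff p' q'" "m' \<oplus> lincomb q' = lincomb p'" and m: "m \<in> Rad" "m' \<in> Rad"
    using assms by (auto simp: represents_def)
  have "f - f' \<in> cone \<longleftrightarrow> lincomb q \<oplus> lincomb p' \<sqsubseteq> lincomb p \<oplus> lincomb q'"
    using * by (simp add: int_diff_simps int_diff_cone_iff lincomb_add)
  also have "\<dots> \<longleftrightarrow> m' \<oplus> (lincomb q \<oplus> lincomb q') \<sqsubseteq> m \<oplus> (lincomb q \<oplus> lincomb q')"
    unfolding *(2,4)[symmetric] using m by (simp add: oplus_ac)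
  also have "\<dots> \<longleftrightarrow> m' \<sqsubseteq> m" using m by (simp add: Rad_cancel_le)
  finally show ?thesis by blast
qed

lemma unit_form_cone:
  assumes "k < n" shows "unit_form k \<in> cone"
proof -
  have "unit_form k - 0 \<in> cone"
    using represents_le_iff[OF represents_unit[OF assms] represents_zero] g_Rad[of k] zero_le by blast
  then show ?thesis by simp
qed

lemma represents_diff:
  assumes r: "represents m f" "represents m' f'"
  shows "represents (m \<ominus> m') (pos_form cone (f - f'))"
proof (cases "f - f' \<in> cone")
  case True
  then have "m' \<sqsubseteq> m" using represents_le_iff[OF r] by simp
  obtain p q p' q' where *: "f = int_diff p q" "m \<oplus> lincomb q = lincomb p"
    "f' = int_diff p' q'" "m' \<oplus> lincomb q' = lincomb p'" and m: "m \<in> Rad" "m' \<in> Rad"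
    using assms by (auto simp: represents_def)
  define d where "d = m \<ominus> m'"
  have d: "d \<in> Rad" using m Rad_down[of m "m \<ominus> m'"] by (simp add: diff_le d_def)
  have dm: "d \<oplus> m' = m"
    using \<open>m' \<sqsubseteq> m\<close> m by (simp add: diff_oplus[of m m'] le_iff_diff d_def)
  have "d \<oplus> (lincomb q \<oplus> (m' \<oplus> lincomb q')) = ((d \<oplus> m') \<oplus> lincomb q) \<oplus> lincomb q'"
    using m d by (simp add: oplus_ac)
  then have "d \<oplus> lincomb (q + p') = lincomb (p + q')" by (simp add: lincomb_add dm *)
  moreover have "f - f' = int_diff (p + q') (q + p')" using * by (simp add: int_diff_simps)
  ultimately show ?thesis using True d unfolding represents_def pos_form_def d_def by auto
next
  case False
  then have "m \<sqsubseteq> m'" using represents_le_iff[OF r] chain[of m m'] r by (auto simp: represents_def)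
  then have "m \<ominus> m' = \<zero>" using r by (simp add: represents_def le_iff_diff)
  then show ?thesis using False represents_zero by (simp add: pos_form_def)
qed

end

text \<open>
  An assignment \<open>v\<close> in the chain is replaced by an assignment \<open>w\<close> in the Chang algebra as follows. Each
  \<open>v k\<close> is an infinitesimal \<open>g k\<close> or its negation, and \<open>total_cone_sign_realization\<close> supplies integers
  \<open>h k\<close> that decide all comparisons for \<open>s\<close> and \<open>t\<close> as the \<open>g k\<close> do; \<open>w k\<close> is \<open>(0, h k)\<close> or its
  negation. Then both evaluations follow the same symbolic one, and equality of the two values in the
  Chang algebra forces equality in the chain.
\<close>

theorem (in perfect_chain) satisfies_Chang_identities:
  fixes s t :: "nat mv_term"
  assumes sat: "satisfies Chang (s, t)"
  shows "satisfies A (s, t)"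
  unfolding satisfies_def
proof clarify
  fix v :: "nat \<Rightarrow> 'a" assume v: "v \<in> UNIV \<rightarrow> carrier A"
  have "finite (vars (Plus s t))" by (induction "Plus s t") auto
  then obtain n where n: "vars (Plus s t) \<subseteq> {..<n}"
    using finite_nat_iff_bounded by blast
  define \<beta> where "\<beta> k \<longleftrightarrow> v k \<notin> Rad" for k
  define g where "g k = (if \<beta> k then \<sim> (v k) else v k)" for k
  have vc: "v k \<in> carrier A" for k using v by auto
  have "g k \<in> Rad" for k using neg_Rad_iff[OF vc, of k] by (simp add: g_def \<beta>_def)
  then interpret perfect_chain_gens A g n by unfold_locales
  have vg: "v k = (if \<beta> k then \<sim> (g k) else g k)" for k using vc by (simp add: g_def)
  define X where "X = comparisons cone \<beta> (Plus s t) \<union> unit_form ` {..<n}"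
  have "finite X" by (simp only: X_def finite_Un finite_comparisons finite_imageI finite_lessThan)
  moreover have "f i = 0" if "f \<in> X" "n \<le> i" for f i
    using that comparisons_support[OF n that(2)] by (auto simp: X_def unit_form_def simp del: comparisons.simps)
  ultimately obtain h where h: "\<And>f. f \<in> X \<Longrightarrow> f \<in> cone \<longleftrightarrow> 0 \<le> (\<Sum>i<n. f i * h i)"
    using total_cone_sign_realization[OF total_cone_cone, of X n] by blast
  define \<phi> where "\<phi> f = (\<Sum>i<n. f i * h i)" for f :: "nat \<Rightarrow> int"
  have \<phi>: "\<phi> (f + f') = \<phi> f + \<phi> f'" "\<phi> (f - f') = \<phi> f - \<phi> f'" "\<phi> 0 = 0" for f f'
    by (simp_all add: \<phi>_def distrib_right left_diff_distrib sum.distrib sum_subtractf)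
  have h: "f \<in> cone \<longleftrightarrow> 0 \<le> \<phi> f" if "f \<in> X" for f using h[OF that] by (simp add: \<phi>_def)
  have \<phi>_unit: "0 \<le> \<phi> (unit_form k)" for k
  proof (cases "k < n")
    case True
    then show ?thesis using h[of "unit_form k"] unit_form_cone by (simp add: X_def)
  next
    case False
    then have "\<phi> (unit_form k) = 0" unfolding \<phi>_def by (intro sum.neutral) (auto simp: unit_form_def)
    then show ?thesis by simp
  qed
  define R where "R m f \<longleftrightarrow> m = (0, \<phi> f) \<and> 0 \<le> \<phi> f" for m :: "int \<times> int" and f
  define w where "w k = (if \<beta> k then neg Chang (0, \<phi> (unit_form k)) else (0, \<phi> (unit_form k)))" for k
  interpret C: mv_algebra Chang by (rule mv_algebra_Chang)
  have w: "w \<in> UNIV \<rightarrow> carrier Chang"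
    using \<phi>_unit C.neg_closed by (auto simp: w_def Chang_simps(1))
  let ?S = "sym_eval cone \<beta>"
  \<comment> \<open>The last two differences, which decide whether the final values agree, are comparisons of
    \<open>Plus s t\<close>.\<close>
  have sub: "comparisons cone \<beta> s \<subseteq> X" "comparisons cone \<beta> t \<subseteq> X"
    "snd (?S s) - snd (?S t) \<in> X" "snd (?S t) - snd (?S s) \<in> X"
    by (auto simp: X_def)
  have evC: "\<exists>m. R m (snd (?S r)) \<and> mv_eval Chang w r = (if fst (?S r) then neg Chang m else m)"
    if "comparisons cone \<beta> r \<subseteq> X" for r
  proof (rule C.eval_sym_eval[where T = X])
    \<comment> \<open>On \<open>X\<close>, membership in the cone is nonnegativity of \<open>\<phi>\<close>.\<close>
    show "R (mv_diff Chang m m') (pos_form cone (f - f'))" if "R m f" "R m' f'" "f - f' \<in> X" for m f m' f'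
      using that h[OF that(3)] by (auto simp: R_def pos_form_def mv_diff_def Chang_simps \<phi>)
    show "mv_le Chang m (neg Chang m')" if "R m f" "R m' f'" for m f m' f'
      using that by (auto simp: R_def mv_le_def mv_join_def Chang_simps)
  qed (use \<phi>_unit that in \<open>auto simp: R_def Chang_simps \<phi> \<phi>[unfolded plus_fun_def zero_fun_def] w_def\<close>)
  have evA: "\<exists>m. represents m (snd (?S r)) \<and> mv_eval A v r = (if fst (?S r) then \<sim> m else m)"
    if "vars r \<subseteq> {..<n}" for r
  proof (rule eval_sym_eval[where T = UNIV])
    show "\<exists>m. represents m (unit_form k) \<and> v k = (if \<beta> k then \<sim> m else m)" if "k \<in> vars r" for k
      using represents_unit[of k] vg[of k] that \<open>vars r \<subseteq> {..<n}\<close> by blast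
    show "m \<sqsubseteq> \<sim> m'" if "represents m f" "represents m' f'" for m f m' f'
      using that Rad_le_neg by (auto simp: represents_def)
    show "represents (m \<ominus> m') (pos_form cone (f - f'))" if "represents m f" "represents m' f'" for m f m' f'
      using represents_diff[OF that] .
    show "m \<in> carrier A" if "represents m f" for m f using that by (auto simp: represents_def)
  qed (rule represents_zero represents_add subset_UNIV; assumption?)+
  have "mv_eval Chang w s = mv_eval Chang w t" using sat w by (auto simp: satisfies_def)
  then have eq: "fst (?S s) = fst (?S t)" "\<phi> (snd (?S s)) = \<phi> (snd (?S t))"
    using evC[OF sub(1)] evC[OF sub(2)] by (auto simp: R_def Chang_simps split: if_splits)
  obtain m m' where m: "represents m (snd (?S s))" "mv_eval A v s = (if fst (?S s) then \<sim> m else m)"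
    and m': "represents m' (snd (?S t))" "mv_eval A v t = (if fst (?S t) then \<sim> m' else m')"
    using evA[of s] evA[of t] n by auto
  have "snd (?S s) - snd (?S t) \<in> cone" "snd (?S t) - snd (?S s) \<in> cone"
    using eq(2) sub(3,4) by (simp_all add: h \<phi>)
  then have "m' \<sqsubseteq> m" "m \<sqsubseteq> m'" using represents_le_iff m(1) m'(1) by blast+
  then have "m = m'" using le_antisym m(1) m'(1) by (simp add: represents_def)
  then show "mv_eval A v s = mv_eval A v t" using m m' eq by simp
qed

section \<open>The characterization\<close>

lemma (in mv_algebra) perfect_chain_quot:
  assumes P: "prime_mv_ideal A P" and perfect: "perfect_mv_ideal A P"
  shows "perfect_chain (mv_quot A P)"
proof -
  have idP: "mv_ideal A P" using P by (simp add: prime_mv_ideal_def)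
  interpret Q: mv_algebra "mv_quot A P" by (rule mv_algebra_quot[OF idP])
  have le: "mv_le (mv_quot A P) (cls P x) (cls P y)"
    if "x \<in> carrier A" "y \<in> carrier A" "x \<ominus> y \<in> P" for x y
  proof -
    have "cls P (x \<ominus> y) = cls P \<zero>" using that by (simp add: cls_eq_iff[OF idP] ideal_zero[OF idP])
    then have "mv_diff (mv_quot A P) (cls P x) (cls P y) = zero (mv_quot A P)"
      using that by (simp add: quot_zero flip: hom_diff[OF cls_hom[OF idP]])
    then show ?thesis using that by (subst Q.le_iff_diff) (auto simp: quot_carrier)
  qed
  show ?thesis
  proof unfold_locales
    show "perfect_mv (mv_quot A P)" using perfect by (simp add: perfect_mv_ideal_def)
    show "mv_le (mv_quot A P) x y \<or> mv_le (mv_quot A P) y x"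
      if "x \<in> carrier (mv_quot A P)" "y \<in> carrier (mv_quot A P)" for x y
    proof -
      obtain a b where "a \<in> carrier A" "x = cls P a" "b \<in> carrier A" "y = cls P b"
        using \<open>x \<in> _\<close> \<open>y \<in> _\<close> unfolding quot_carrier by blast
      then show ?thesis using le[of a b] le[of b a] prime_diff[OF P, of a b] by blast
    qed
  qed
qed

text \<open>
  If an identity of the Chang algebra failed in \<open>A\<close>, one of the two differences of its sides would be
  nonzero and so avoid some prime ideal \<open>P\<close>; the identity would then fail in the perfect chain \<open>A/P\<close>.
\<close>

theorem (in mv_algebra) perfect_primes_imp_in_variety_Chang:
  assumes perfect: "\<forall>P \<in> Spec A. perfect_mv_ideal A P"
  shows "in_variety Chang A"
proof -
  have diff: "mv_eval A v s \<ominus> mv_eval A v t = \<zero>"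
    if sat: "satisfies Chang (s, t)" and v: "v \<in> UNIV \<rightarrow> carrier A" for s t :: "nat mv_term" and v
  proof (rule ccontr)
    assume "mv_eval A v s \<ominus> mv_eval A v t \<noteq> \<zero>"
    moreover have c: "mv_eval A v r \<in> carrier A" for r using v by (auto intro!: eval_closed)
    ultimately obtain P where P: "prime_mv_ideal A P" "mv_eval A v s \<ominus> mv_eval A v t \<notin> P"
      using exists_prime_avoiding by blast
    then have idP: "mv_ideal A P" by (simp add: prime_mv_ideal_def)
    note hom = cls_hom[OF idP]
    have "perfect_mv_ideal A P" using perfect P(1) by (simp add: Spec_def)
    from perfect_chain_quot[OF P(1) this] sat
    have "satisfies (mv_quot A P) (s, t)" by (rule perfect_chain.satisfies_Chang_identities)
    moreover have "cls P \<circ> v \<in> UNIV \<rightarrow> carrier (mv_quot A P)" using v by (auto simp: quot_carrier)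
    ultimately have "cls P (mv_eval A v s) = cls P (mv_eval A v t)"
      using mv_hom_eval[OF mv_algebra_axioms hom v] by (simp add: satisfies_def)
    then show False using P(2) c by (simp add: cls_eq_iff[OF idP])
  qed
  have "mv_eval A v s = mv_eval A v t"
    if sat: "satisfies Chang (s, t)" and v: "v \<in> UNIV \<rightarrow> carrier A" for s t :: "nat mv_term" and v
  proof -
    have "satisfies Chang (t, s)" using sat by (simp add: satisfies_def)
    moreover have "mv_eval A v r \<in> carrier A" for r using v by (auto intro!: eval_closed)
    ultimately show ?thesis using diff[OF sat v] diff[OF _ v] by (simp add: le_antisym le_iff_diff)
  qed
  then show ?thesis using mv_algebra_axioms by (auto simp: in_variety_def satisfies_def)
qed

theorem theorem8p2:
  fixes K :: "'k set" and I :: "'k mv_term set set" and A :: "'k mv_term set set mv"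
  assumes "mv_ideal (Free K) I"
    and "A = mv_quot (Free K) I"
  shows "(in_variety Chang A \<longleftrightarrow> (\<forall>M. maximal_mv_ideal A M \<longrightarrow> supermaximal_mv_ideal A M)) \<and>
    ((\<forall>M. maximal_mv_ideal A M \<longrightarrow> supermaximal_mv_ideal A M)
      \<longleftrightarrow> (\<forall>P \<in> Spec A. perfect_mv_ideal A P)) \<and>
    ((\<forall>P \<in> Spec A. perfect_mv_ideal A P)
      \<longleftrightarrow> (\<forall>P \<in> Spec_above K I. perfect_mv_ideal (Free K) P))"
proof -
  interpret F: mv_algebra "Free K" by (rule mv_algebra_Free)
  interpret mv_algebra A using F.mv_algebra_quot assms by simp
  have "in_variety Chang A \<Longrightarrow> \<forall>M. maximal_mv_ideal A M \<longrightarrow> supermaximal_mv_ideal A M"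
    using in_variety_Chang_imp_supermaximal by blast
  moreover have "\<forall>P \<in> Spec A. perfect_mv_ideal A P"
    if "\<forall>M. maximal_mv_ideal A M \<longrightarrow> supermaximal_mv_ideal A M"
    using that perfect_prime_ideal_if_supermaximal by (simp add: Spec_def)
  moreover have "\<forall>M. maximal_mv_ideal A M \<longrightarrow> supermaximal_mv_ideal A M"
    if "\<forall>P \<in> Spec A. perfect_mv_ideal A P"
    using that maximal_ideal_prime supermaximal_if_perfect by (simp add: Spec_def)
  moreover have "(\<forall>P \<in> Spec A. perfect_mv_ideal A P) \<longleftrightarrow>
      (\<forall>P \<in> Spec_above K I. perfect_mv_ideal (Free K) P)"
    using F.perfect_primes_quotient_iff[OF assms(1)] by (simp only: assms(2) Spec_above_def)
  ultimately show ?thesis using perfect_primes_imp_in_variety_Chang by blast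
qed

end
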